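(* Let $n\ge 1$ and let $\Sigma=L_1\cup\cdots\cup L_n\subset\mathbb{CP}^2$ be a union of $n$ complex projective lines. Then the fundamental group $\pi_1(\mathbb{CP}^2\setminus\Sigma)$ is a free group if and only if $L_1\cap\cdots\cap L_n\neq\emptyset$.
   Context: $\mathbb{CP}^2$ is the complex projective plane. The fundamental group is that of the complement with its topology induced from $\mathbb{CP}^2$ (the complement is path connected, so the base point is irrelevant). The trivial group counts as a free group (of rank $0$). *)

theory Defs
  imports "HOL-Analysis.Analysis" "HOL-Algebra.Group"
begin

section \<open>The complex projective plane\<close>

definition proj_rel :: "complex ^ 3 \<Rightarrow> complex ^ 3 \<Rightarrow> bool" where
  "proj_rel v w \<longleftrightarrow> v \<noteq> 0 \<and> w \<noteq> 0 \<and> (\<exists>c. w = c *s v)"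

lemma part_equivp_proj_rel: "part_equivp proj_rel"
proof (rule part_equivpI)
  have "proj_rel (axis 1 1) (axis 1 1)"
    unfolding proj_rel_def by (auto simp: axis_eq_0_iff intro!: exI[of _ 1])
  then show "\<exists>v. proj_rel v v" ..
  show "symp proj_rel"
  proof (rule sympI)
    fix v w assume *: "proj_rel v w"
    then obtain c where c: "w = c *s v" by (auto simp: proj_rel_def)
    with * have "c \<noteq> 0" by (auto simp: proj_rel_def)
    with c have "v = inverse c *s w" by (simp add: vector_smult_assoc)
    with * show "proj_rel w v" unfolding proj_rel_def by blast
  qed
  show "transp proj_rel"
    by (rule transpI) (auto simp: proj_rel_def vector_smult_assoc)
qed

quotient_type cp2 = "complex ^ 3" / partial: proj_rel
  by (rule part_equivp_proj_rel)

text \<open>\<^term>\<open>abs_cp2 v\<close> is the point with homogeneous coordinates \<open>v\<close>; it is only meaningful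
  for \<open>v \<noteq> 0\<close>.\<close>

lemma abs_cp2_eq_iff:
  assumes "v \<noteq> 0" "w \<noteq> 0"
  shows "abs_cp2 v = abs_cp2 w \<longleftrightarrow> (\<exists>c. w = c *s v)"
proof -
  have "proj_rel u u" if "u \<noteq> 0" for u
    using that unfolding proj_rel_def by (auto intro!: exI[of _ 1])
  then show ?thesis
    using assms Quotient_rel[OF Quotient_cp2, of v w] by (auto simp: proj_rel_def)
qed

lemma cp2_exhaust: obtains v where "v \<noteq> 0" "p = abs_cp2 v"
proof
  have "proj_rel (rep_cp2 p) (rep_cp2 p)"
    using Quotient_cp2 by (rule Quotient_rep_reflp)
  then show "rep_cp2 p \<noteq> 0" by (simp add: proj_rel_def)
  show "p = abs_cp2 (rep_cp2 p)"
    using Quotient_cp2 by (simp add: Quotient_abs_rep)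
qed

text \<open>The quotient topology of \<open>\<complex>\<^sup>3 - {0}\<close>. As \<open>\<complex>\<^sup>3 - {0}\<close> is open in \<open>\<complex>\<^sup>3\<close>, it
  does not matter in which of the two the preimage is required to be open.\<close>

instantiation cp2 :: topological_space
begin

definition open_cp2 :: "cp2 set \<Rightarrow> bool" where
  "open_cp2 U \<longleftrightarrow> open {v. v \<noteq> 0 \<and> abs_cp2 v \<in> U}"

instance
proof
  have "{v :: complex ^ 3. v \<noteq> 0 \<and> abs_cp2 v \<in> UNIV} = - {0}" by auto
  then show "open (UNIV :: cp2 set)"
    by (simp add: open_cp2_def open_Compl)
next
  fix S T :: "cp2 set"
  assume "open S" "open T"
  then have "open ({v. v \<noteq> 0 \<and> abs_cp2 v \<in> S} \<inter> {v. v \<noteq> 0 \<and> abs_cp2 v \<in> T})"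
    unfolding open_cp2_def by (rule open_Int)
  also have "{v. v \<noteq> 0 \<and> abs_cp2 v \<in> S} \<inter> {v. v \<noteq> 0 \<and> abs_cp2 v \<in> T}
      = {v. v \<noteq> 0 \<and> abs_cp2 v \<in> S \<inter> T}" by auto
  finally show "open (S \<inter> T)" unfolding open_cp2_def .
next
  fix K :: "cp2 set set"
  assume "\<forall>S\<in>K. open S"
  then have "open (\<Union>S\<in>K. {v. v \<noteq> 0 \<and> abs_cp2 v \<in> S})"
    by (intro open_UN) (auto simp: open_cp2_def)
  also have "(\<Union>S\<in>K. {v. v \<noteq> 0 \<and> abs_cp2 v \<in> S}) = {v. v \<noteq> 0 \<and> abs_cp2 v \<in> \<Union>K}" by auto
  finally show "open (\<Union>K)" unfolding open_cp2_def .
qed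

end

lemma quotient_map_abs_cp2: "quotient_map (top_of_set (- {0})) euclidean abs_cp2"
proof -
  have "abs_cp2 ` (- {0}) = UNIV"
    by (metis (no_types, lifting) cp2_exhaust Compl_iff imageI singletonD surjI UNIV_eq_I)
  moreover have "openin (top_of_set (- {0})) {v. v \<noteq> 0 \<and> abs_cp2 v \<in> U} \<longleftrightarrow> open U" for U
    by (subst openin_open_eq) (auto simp: open_cp2_def)
  ultimately show ?thesis
    by (simp add: quotient_map_def)
qed

definition proj_line :: "cp2 set \<Rightarrow> bool" where
  "proj_line l \<longleftrightarrow>
    (\<exists>a :: complex ^ 3. a \<noteq> 0 \<and> l = abs_cp2 ` {v. v \<noteq> 0 \<and> (\<Sum>i\<in>UNIV. a $ i * v $ i) = 0})"


section \<open>The fundamental group\<close>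

definition loops_at :: "'a :: topological_space set \<Rightarrow> 'a \<Rightarrow> (real \<Rightarrow> 'a) set" where
  "loops_at S x = {p. path p \<and> path_image p \<subseteq> S \<and> pathstart p = x \<and> pathfinish p = x}"

definition path_class :: "'a :: topological_space set \<Rightarrow> (real \<Rightarrow> 'a) \<Rightarrow> (real \<Rightarrow> 'a) set" where
  "path_class S p = {q. homotopic_paths S p q}"

definition fundamental_group ::
    "'a :: topological_space set \<Rightarrow> 'a \<Rightarrow> (real \<Rightarrow> 'a) set monoid" where
  "fundamental_group S x =
    \<lparr> carrier = path_class S ` loops_at S x,
      mult = (\<lambda>A B. \<Union>p\<in>A. \<Union>q\<in>B. path_class S (p +++ q)),
      one = path_class S (\<lambda>_. x) \<rparr>"

lemma path_class_eq_iff: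
  assumes "p \<in> loops_at S x"
  shows "path_class S p = path_class S q \<longleftrightarrow> homotopic_paths S p q"
proof
  assume "path_class S p = path_class S q"
  moreover have "p \<in> path_class S p"
    using assms by (simp add: path_class_def loops_at_def)
  ultimately show "homotopic_paths S p q"
    by (auto simp: path_class_def intro: homotopic_paths_sym)
next
  assume "homotopic_paths S p q"
  then show "path_class S p = path_class S q"
    unfolding path_class_def by (blast intro: homotopic_paths_trans homotopic_paths_sym)
qed

lemma join_in_loops_at:
  "p \<in> loops_at S x \<Longrightarrow> q \<in> loops_at S x \<Longrightarrow> p +++ q \<in> loops_at S x"
  by (auto simp: loops_at_def subset_path_image_join)

lemma const_in_loops_at: "x \<in> S \<Longrightarrow> (\<lambda>_. x) \<in> loops_at S x"
  by (auto simp: loops_at_def path_def path_image_def pathstart_def pathfinish_def)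

lemma mult_path_class:
  assumes "p \<in> loops_at S x" "q \<in> loops_at S x"
  shows "path_class S p \<otimes>\<^bsub>fundamental_group S x\<^esub> path_class S q = path_class S (p +++ q)"
proof -
  have "path_class S (p' +++ q') = path_class S (p +++ q)"
    if "p' \<in> path_class S p" "q' \<in> path_class S q" for p' q'
  proof -
    have "homotopic_paths S (p +++ q) (p' +++ q')"
      using that assms by (intro homotopic_paths_join) (auto simp: path_class_def loops_at_def)
    then show ?thesis
      using path_class_eq_iff[OF join_in_loops_at[OF assms]] by metis
  qed
  moreover have "p \<in> path_class S p" "q \<in> path_class S q"
    using assms by (auto simp: path_class_def loops_at_def)
  ultimately have "(\<Union>p\<in>path_class S p. \<Union>q\<in>path_class S q. path_class S (p +++ q))
      = path_class S (p +++ q)" by blast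
  then show ?thesis by (simp add: fundamental_group_def)
qed

lemma homotopic_const_join:
  fixes p :: "real \<Rightarrow> 'a :: topological_space"
  assumes "p \<in> loops_at S x"
  shows "homotopic_paths S p ((\<lambda>_. x) +++ p)"
proof (rule homotopic_paths_reparametrize[where f = "\<lambda>t. max 0 (2 * t - 1)"])
  show "((\<lambda>_. x) +++ p) t = p (max 0 (2 * t - 1))" if "t \<in> {0..1}" for t
  proof (cases "t \<le> 1/2")
    case True
    then have "max 0 (2 * t - 1) = 0" by (simp add: max_def)
    then show ?thesis
      using True assms by (simp add: joinpaths_def loops_at_def pathstart_def)
  next
    case False
    then have "max 0 (2 * t - 1) = 2 * t - 1" by (simp add: max_def)
    then show ?thesis
      using False by (simp add: joinpaths_def)
  qed
qed (use assms in \<open>auto simp: loops_at_def intro!: continuous_intros\<close>)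

lemma homotopic_reversepath_join:
  fixes p :: "real \<Rightarrow> 'a :: topological_space"
  assumes "p \<in> loops_at S x"
  shows "homotopic_paths S (reversepath p +++ p) (\<lambda>_. x)"
proof -
  have p: "continuous_on {0..1} p" "p ` {0..1} \<subseteq> S" "p 0 = x" "p 1 = x"
    using assms by (auto simp: loops_at_def path_def path_image_def pathstart_def pathfinish_def)
  let ?h = "\<lambda>(s, t). p (max s \<bar>1 - 2 * t\<bar>)"
  have m: "max s \<bar>1 - 2 * t\<bar> \<in> {0..1}" if "s \<in> {0..1}" "t \<in> {0..1}" for s t :: real
    using that by auto
  show ?thesis
    unfolding homotopic_paths
  proof (intro exI[of _ ?h] conjI ballI)
    have "continuous_on ({0..1} \<times> {0..1}) (\<lambda>z. p (max (fst z) \<bar>1 - 2 * snd z\<bar>))"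
      by (rule continuous_on_compose2[OF p(1)]) (use m in \<open>auto intro!: continuous_intros\<close>)
    then show "continuous_on ({0..1} \<times> {0..1}) ?h"
      by (simp add: case_prod_beta)
    show "?h \<in> {0..1} \<times> {0..1} \<rightarrow> S"
      using m p(2) by (auto simp del: atLeastAtMost_iff simp: image_subset_iff)
    fix t :: real assume t: "t \<in> {0..1}"
    show "?h (0, t) = (reversepath p +++ p) t"
      by (simp add: joinpaths_def reversepath_def)
    have "max 1 \<bar>1 - 2 * t\<bar> = 1" using t by auto
    then show "?h (1, t) = x" using p by simp
    have "max t 1 = 1" using t by auto
    then show "pathstart (?h \<circ> Pair t) = pathstart (reversepath p +++ p)"
      "pathfinish (?h \<circ> Pair t) = pathfinish (reversepath p +++ p)"
      using p by (simp_all add: pathstart_def pathfinish_def joinpaths_def reversepath_def)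
  qed
qed

lemma group_fundamental_group:
  assumes "x \<in> S"
  shows "group (fundamental_group S x)"
proof -
  let ?G = "fundamental_group S x"
  have carrier: "carrier ?G = path_class S ` loops_at S x"
    and one: "\<one>\<^bsub>?G\<^esub> = path_class S (\<lambda>_. x)"
    by (simp_all add: fundamental_group_def)
  note [simp] = mult_path_class join_in_loops_at const_in_loops_at[OF assms]
  show ?thesis
  proof (rule groupI)
    fix A B C assume "A \<in> carrier ?G" "B \<in> carrier ?G" "C \<in> carrier ?G"
    then obtain p q r where [simp]: "A = path_class S p" "B = path_class S q" "C = path_class S r"
      and pqr [simp]: "p \<in> loops_at S x" "q \<in> loops_at S x" "r \<in> loops_at S x"
      unfolding carrier by blast
    have "homotopic_paths S (p +++ (q +++ r)) ((p +++ q) +++ r)"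
      using pqr unfolding loops_at_def by (intro homotopic_paths_assoc) auto
    then have "homotopic_paths S ((p +++ q) +++ r) (p +++ (q +++ r))"
      by (rule homotopic_paths_sym)
    then show "A \<otimes>\<^bsub>?G\<^esub> B \<otimes>\<^bsub>?G\<^esub> C = A \<otimes>\<^bsub>?G\<^esub> (B \<otimes>\<^bsub>?G\<^esub> C)"
      by (simp add: path_class_eq_iff[of _ S x])
  next
    fix A assume "A \<in> carrier ?G"
    then obtain p where [simp]: "A = path_class S p" and p [simp]: "p \<in> loops_at S x"
      unfolding carrier by blast
    show "\<one>\<^bsub>?G\<^esub> \<otimes>\<^bsub>?G\<^esub> A = A"
      using homotopic_const_join[OF p] by (metis one \<open>A = _\<close> mult_path_class p
          const_in_loops_at[OF assms] path_class_eq_iff)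
    have "reversepath p \<in> loops_at S x"
      using p by (auto simp: loops_at_def)
    moreover from this have "path_class S (reversepath p) \<otimes>\<^bsub>?G\<^esub> A = \<one>\<^bsub>?G\<^esub>"
      using homotopic_reversepath_join[OF p] by (simp add: one path_class_eq_iff[of _ S x])
    ultimately show "\<exists>B\<in>carrier ?G. B \<otimes>\<^bsub>?G\<^esub> A = \<one>\<^bsub>?G\<^esub>"
      unfolding carrier by blast
  qed (auto simp: carrier one)
qed


section \<open>Free groups\<close>

text \<open>Words in the generators and their inverses: \<open>(x, True)\<close> stands for the generator \<open>x\<close>
  and \<open>(x, False)\<close> for its inverse.\<close>

type_synonym 'a word = "('a \<times> bool) list"

definition inv_letter :: "'a \<times> bool \<Rightarrow> 'a \<times> bool" where
  "inv_letter l = (fst l, \<not> snd l)"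

definition reduced_word :: "'a word \<Rightarrow> bool" where
  "reduced_word w \<longleftrightarrow> successively (\<lambda>l m. m \<noteq> inv_letter l) w"

text \<open>Prepending a letter to a reduced word, followed by cancellation.\<close>

fun push :: "'a \<times> bool \<Rightarrow> 'a word \<Rightarrow> 'a word" where
  "push l [] = [l]"
| "push l (m # w) = (if m = inv_letter l then w else l # m # w)"

definition free_group :: "'a set \<Rightarrow> 'a word monoid" where
  "free_group X =
    \<lparr> carrier = {w. reduced_word w \<and> fst ` set w \<subseteq> X},
      mult = (\<lambda>v w. foldr push v w),
      one = [] \<rparr>"

text \<open>Letting the generators range over the element type of \<open>G\<close> is no restriction: a basis of
  \<open>G\<close> can be taken inside \<open>carrier G\<close>.\<close>

definition is_free_group :: "('a, 'b) monoid_scheme \<Rightarrow> bool" where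
  "is_free_group G \<longleftrightarrow> group G \<and> (\<exists>X :: 'a set. free_group X \<cong> G)"

lemma inv_letter_inv_letter [simp]: "inv_letter (inv_letter l) = l"
  by (simp add: inv_letter_def)

lemma fst_inv_letter [simp]: "fst (inv_letter l) = fst l"
  by (simp add: inv_letter_def)

lemma inv_letter_neq [simp]: "inv_letter l \<noteq> l" "l \<noteq> inv_letter l"
  by (auto simp: inv_letter_def prod_eq_iff)

lemma reduced_Nil [simp]: "reduced_word []"
  by (simp add: reduced_word_def)

lemma reduced_Cons: "reduced_word (l # w) \<longleftrightarrow> (w = [] \<or> hd w \<noteq> inv_letter l) \<and> reduced_word w"
  by (auto simp: reduced_word_def successively_Cons)

lemma reduced_push: "reduced_word w \<Longrightarrow> reduced_word (push l w)"
  by (cases w) (auto simp: reduced_Cons)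

lemma reduced_foldr_push: "reduced_word w \<Longrightarrow> reduced_word (foldr push v w)"
  by (induction v) (auto intro: reduced_push)

lemma push_inv_letter: "reduced_word w \<Longrightarrow> push (inv_letter l) (push l w) = w"
  by (cases w rule: remdups_adj.cases) (auto simp: reduced_Cons)

lemma foldr_push_push: "reduced_word w \<Longrightarrow> foldr push (push l v) w = push l (foldr push v w)"
  using push_inv_letter[of _ "inv_letter l"]
  by (cases v) (auto simp: reduced_foldr_push)

lemma foldr_push_assoc:
  "reduced_word w \<Longrightarrow> foldr push (foldr push u v) w = foldr push u (foldr push v w)"
  by (induction u) (auto simp: foldr_push_push)

lemma set_push: "set (push l w) \<subseteq> insert l (set w)"
  by (cases w) auto

lemma set_foldr_push: "set (foldr push v w) \<subseteq> set v \<union> set w"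
  using set_push by (induction v) fastforce+

lemma foldr_push_Nil: "reduced_word w \<Longrightarrow> foldr push w [] = w"
proof (induction w)
  case (Cons l w)
  then show ?case by (cases w) (auto simp: reduced_Cons)
qed simp

lemma foldr_push_inverse:
  "reduced_word w \<Longrightarrow> foldr push (rev (map inv_letter v)) (foldr push v w) = w"
proof (induction v)
  case (Cons l v)
  then show ?case by (simp add: push_inv_letter reduced_foldr_push)
qed simp

lemma group_free_group: "group (free_group X)"
proof (rule groupI)
  fix v w assume "v \<in> carrier (free_group X)" "w \<in> carrier (free_group X)"
  moreover have "fst ` set (foldr push v w) \<subseteq> fst ` set v \<union> fst ` set w"
    using set_foldr_push[of v w] by (metis image_Un image_mono)
  ultimately show "v \<otimes>\<^bsub>free_group X\<^esub> w \<in> carrier (free_group X)"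
    unfolding free_group_def by (simp add: reduced_foldr_push) (rule subset_trans, auto)
next
  fix w assume w: "w \<in> carrier (free_group X)"
  let ?v = "foldr push (rev (map inv_letter w)) []"
  have "fst ` set ?v \<subseteq> fst ` set (rev (map inv_letter w))"
    using set_foldr_push[of "rev (map inv_letter w)" "[]"] by (intro image_mono) simp
  also have "\<dots> = fst ` set w"
    by (simp add: image_image)
  finally have "?v \<in> carrier (free_group X)"
    using w unfolding free_group_def
    by (simp add: reduced_foldr_push) (rule subset_trans, auto)
  moreover have "?v \<otimes>\<^bsub>free_group X\<^esub> w = \<one>\<^bsub>free_group X\<^esub>"
  proof -
    have "foldr push ?v w = foldr push (rev (map inv_letter w)) (foldr push w [])"
      using w by (simp add: free_group_def foldr_push_assoc foldr_push_Nil)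
    then show ?thesis by (simp add: free_group_def foldr_push_inverse)
  qed
  ultimately show "\<exists>v\<in>carrier (free_group X). v \<otimes>\<^bsub>free_group X\<^esub> w = \<one>\<^bsub>free_group X\<^esub>" by blast
qed (auto simp: free_group_def foldr_push_assoc)

end

theory Submission
  imports Defs "HOL-Complex_Analysis.Complex_Analysis"
begin

text \<open>Suppose first that the lines have no common point. Three of them are then linearly
  independent; they serve as coordinate axes and as the line at infinity, so that the complement
  becomes the complement of affine lines in \<open>\<complex>\<^sup>2\<close> that include both axes. It contains a small torus
  \<open>\<bar>x\<bar> = \<epsilon>\<^sup>2\<close>, \<open>\<bar>y\<bar> = \<epsilon>\<close>. The two circles of the torus commute in the fundamental group, whereas the
  winding numbers of \<open>x\<close> and \<open>y\<close> are two homomorphisms to \<open>\<complex>\<close> separating them. A free group does not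
  allow this, because the cup product of two homomorphisms from a free group vanishes.

  If the lines have a common point, an affine chart at one of the lines turns the others
  into parallel lines, so that the complement deformation retracts to the plane without finitely
  many points. These points may be moved to \<open>1, \<dots>, k\<close>. Counting the crossings of the
  real line maps the fundamental group to a free group; this is inverse to the
  obvious map in the other direction, since both are instances of one construction, which
  transports group elements along paths and is determined by its local behaviour.\<close>

section \<open>Free groups\<close>

text \<open>The two half planes overlap in several intervals, so the group version of van Kampen's
  theorem does not apply to them. Instead one cocycle formula is read twice, with values in the free
  group and in the fundamental group itself. In the second reading the transport of a loop is the
  class of that loop, by uniqueness of lifts. Evaluation of words carries the first cocycle to the
  second, hence also the transports; so every loop is the product of generators that its crossings
  spell out.

  The torus has radii of different order because further lines may pass through the intersection of
  the axes. Such a line b x + c y = 0 with b and c nonzero cannot meet the torus once |x| is much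
  smaller than |y|.

  Retractions fix the base point and homeomorphisms carry it along, so a change of base point occurs
  only once, as conjugation by a path to the torus.\<close>

lemma free_group_simps [simp]:
  "carrier (free_group X) = {w. reduced_word w \<and> fst ` set w \<subseteq> X}"
  "v \<otimes>\<^bsub>free_group X\<^esub> w = foldr push v w"
  "\<one>\<^bsub>free_group X\<^esub> = []"
  by (simp_all add: free_group_def)

lemma push_reduced: "reduced_word (l # w) \<Longrightarrow> push l w = l # w"
  by (cases w) (auto simp: reduced_Cons)

section \<open>Renaming generators\<close>

lemma push_map_letter:
  assumes "inj_on f (insert (fst l) (fst ` set w))"
  shows "push (apfst f l) (map (apfst f) w) = map (apfst f) (push l w)"
proof (cases w)
  case (Cons m w')
  have "apfst f m = inv_letter (apfst f l) \<longleftrightarrow> m = inv_letter l"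
    using assms Cons by (cases l; cases m) (auto simp: inv_letter_def inj_on_def)
  then show ?thesis using Cons by simp
qed simp

lemma foldr_push_map_letter:
  assumes "inj_on f (fst ` set v \<union> fst ` set w)"
  shows "foldr push (map (apfst f) v) (map (apfst f) w)
    = map (apfst f) (foldr push v w)"
  using assms
proof (induction v)
  case (Cons l v)
  have "fst ` set (foldr push v w) \<subseteq> fst ` set v \<union> fst ` set w"
    using set_foldr_push[of v w] by (metis image_Un image_mono)
  then have "inj_on f (insert (fst l) (fst ` set (foldr push v w)))"
    by (intro inj_on_subset[OF Cons.prems]) auto
  moreover have "inj_on f (fst ` set v \<union> fst ` set w)"
    using Cons.prems by (rule inj_on_subset) auto
  ultimately show ?case
    using Cons.IH push_map_letter by simp
qed simp

lemma reduced_map_letter: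
  assumes "inj_on f (fst ` set w)"
  shows "reduced_word (map (apfst f) w) \<longleftrightarrow> reduced_word w"
  using assms
proof (induction w)
  case (Cons l w)
  have "inj_on f (fst ` set w)"
    using Cons.prems by (rule inj_on_subset) auto
  moreover have "apfst f m = inv_letter (apfst f l) \<longleftrightarrow> m = inv_letter l"
    if "m \<in> set w" for m
  proof -
    have "f (fst m) = f (fst l) \<longleftrightarrow> fst m = fst l"
      by (rule inj_on_eq_iff[OF Cons.prems]) (use that in auto)
    then show ?thesis by (cases l; cases m) (auto simp: inv_letter_def)
  qed
  ultimately show ?case
    using Cons.IH by (cases "w = []") (simp_all add: reduced_Cons hd_map)
qed simp

lemma free_group_rename:
  assumes "inj_on f X"
  shows "free_group X \<cong> free_group (f ` X)"
proof -
  let ?F = "map (apfst f)"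
  let ?G = "map (apfst (inv_into X f))"
  have inj: "inj_on f (fst ` set v \<union> fst ` set w)"
    if "fst ` set v \<subseteq> X" "fst ` set w \<subseteq> X" for v w :: "('a \<times> bool) list"
    by (intro inj_on_subset[OF assms]) (use that in auto)
  have "?F \<in> hom (free_group X) (free_group (f ` X))"
    using inj inj[of _ "[]"]
    by (intro homI) (auto simp: reduced_map_letter foldr_push_map_letter image_image)
  moreover have "bij_betw ?F (carrier (free_group X)) (carrier (free_group (f ` X)))"
  proof (rule bij_betw_byWitness[where f' = ?G])
    show "\<forall>w\<in>carrier (free_group X). ?G (?F w) = w"
      using assms by (auto intro!: map_idI simp: subset_iff image_iff)
    show FG: "\<forall>w\<in>carrier (free_group (f ` X)). ?F (?G w) = w"
      by (auto intro!: map_idI simp: f_inv_into_f[of _ f X] image_subset_iff)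
    show "?F ` carrier (free_group X) \<subseteq> carrier (free_group (f ` X))"
      using inj[of _ "[]"] by (auto simp: reduced_map_letter image_subset_iff)
    have *: "inj_on (inv_into X f) (fst ` set w)" if "fst ` set w \<subseteq> f ` X" for w :: "('b \<times> bool) list"
      using that by (rule inj_on_inv_into)
    show "?G ` carrier (free_group (f ` X)) \<subseteq> carrier (free_group X)"
      using * by (auto simp: reduced_map_letter image_subset_iff intro!: inv_into_into)
  qed
  ultimately show ?thesis
    by (auto simp: is_iso_def iso_def)
qed

text \<open>\<open>is_free_group\<close> asks for generators in the element type of
  \<open>G\<close>. A basis of any other type can be moved there: the isomorphism \<open>h\<close>
  is injective on one-letter words, so \<open>x\<close> may be renamed to
  \<open>h [(x, True)]\<close>.\<close>

lemma is_free_groupI: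
  assumes "group G" "free_group X \<cong> G"
  shows "is_free_group G"
proof -
  obtain h where h: "h \<in> iso (free_group X) G"
    using assms by (auto simp: is_iso_def)
  let ?f = "\<lambda>x. h [(x, True)]"
  have "inj_on h (carrier (free_group X))"
    using h by (auto simp: iso_def bij_betw_def)
  then have "inj_on ?f X"
    unfolding inj_on_def[of ?f] by (auto dest!: inj_onD simp: reduced_Cons)
  then have "free_group X \<cong> free_group (?f ` X)"
    by (rule free_group_rename)
  then have "free_group (?f ` X) \<cong> free_group X"
    by (rule group.iso_sym[OF group_free_group])
  then show ?thesis
    unfolding is_free_group_def using assms iso_trans by blast
qed

lemma is_free_group_iso:
  assumes "group G" "is_free_group H" "H \<cong> G"
  shows "is_free_group G"
  using assms unfolding is_free_group_def by (metis is_free_groupI iso_trans is_free_group_def)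

section \<open>Evaluating words in a group\<close>

primrec word_eval :: "('b, 'c) monoid_scheme \<Rightarrow> ('a \<Rightarrow> 'b) \<Rightarrow> 'a word \<Rightarrow> 'b" where
  "word_eval G g [] = \<one>\<^bsub>G\<^esub>"
| "word_eval G g (l # w) =
    (if snd l then g (fst l) else inv\<^bsub>G\<^esub> g (fst l)) \<otimes>\<^bsub>G\<^esub> word_eval G g w"

context group
begin

lemma word_eval_closed [simp]: "g \<in> fst ` set w \<rightarrow> carrier G \<Longrightarrow> word_eval G g w \<in> carrier G"
  by (induction w) auto

lemma word_eval_push:
  assumes "g \<in> fst ` set (l # w) \<rightarrow> carrier G"
  shows "word_eval G g (push l w) = word_eval G g (l # w)"
proof (cases w)
  case (Cons m w')
  have [simp]: "word_eval G g w' \<in> carrier G" "g (fst l) \<in> carrier G"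
    using assms Cons by auto
  show ?thesis
    using Cons by (auto simp: inv_letter_def m_assoc[symmetric])
qed simp

lemma word_eval_foldr_push:
  assumes "g \<in> fst ` (set v \<union> set w) \<rightarrow> carrier G"
  shows "word_eval G g (foldr push v w) = word_eval G g v \<otimes> word_eval G g w"
  using assms
proof (induction v)
  case (Cons l v)
  have "fst ` set (l # foldr push v w) \<subseteq> fst ` (set (l # v) \<union> set w)"
    using set_foldr_push[of v w] by auto
  then have "g \<in> fst ` set (l # foldr push v w) \<rightarrow> carrier G"
    using Cons.prems by blast
  moreover have "word_eval G g v \<in> carrier G" "word_eval G g w \<in> carrier G" "g (fst l) \<in> carrier G"
    using Cons.prems by (auto intro!: word_eval_closed)
  ultimately show ?case
    using Cons by (simp add: word_eval_push m_assoc)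
qed auto

lemma word_eval_hom:
  assumes "g \<in> X \<rightarrow> carrier G"
  shows "word_eval G g \<in> hom (free_group X) G"
proof (rule homI)
  fix v w assume "v \<in> carrier (free_group X)" "w \<in> carrier (free_group X)"
  then have "g \<in> fst ` (set v \<union> set w) \<rightarrow> carrier G"
    using assms by auto
  then show "word_eval G g (v \<otimes>\<^bsub>free_group X\<^esub> w) = word_eval G g v \<otimes> word_eval G g w"
    by (simp add: word_eval_foldr_push)
qed (use assms in \<open>auto intro!: word_eval_closed\<close>)

text \<open>Checking \<open>f\<close> on generators suffices for one composite, by induction on
  reduced words. The other composite is assumed on all of \<open>G\<close>; it contains the fact
  that the elements \<open>g x\<close> generate.\<close>

lemma free_group_isoI:
  assumes g: "g \<in> X \<rightarrow> carrier G"
    and f: "f \<in> hom G (free_group X)"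
    and fg: "\<And>x. x \<in> X \<Longrightarrow> f (g x) = [(x, True)]"
    and gf: "\<And>a. a \<in> carrier G \<Longrightarrow> word_eval G g (f a) = a"
  shows "free_group X \<cong> G"
proof -
  interpret F: group "free_group X" by (rule group_free_group)
  interpret f: group_hom G "free_group X" f by unfold_locales (rule f)
  have inv_gen: "inv\<^bsub>free_group X\<^esub> [(x, True)] = [(x, False)]" if "x \<in> X" for x
    using that by (intro F.inv_equality) (auto simp: reduced_Cons inv_letter_def)
  have fg: "f (word_eval G g w) = w" if "w \<in> carrier (free_group X)" for w
    using that
  proof (induction w)
    case Nil
    then show ?case by (metis f.hom_one free_group_simps(3) word_eval.simps(1))
  next
    case (Cons l w)
    have [simp]: "word_eval G g w \<in> carrier G" "g (fst l) \<in> carrier G" "fst l \<in> X"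
      using Cons.prems g by (auto intro!: word_eval_closed)
    have "f (if snd l then g (fst l) else inv g (fst l)) = [l]"
    proof (cases "snd l")
      case True
      then have "l = (fst l, True)" by (simp add: prod_eq_iff)
      with True show ?thesis using fg[of "fst l"] by simp
    next
      case False
      then have "l = (fst l, False)" by (simp add: prod_eq_iff)
      moreover have "f (inv g (fst l)) = [(fst l, False)]"
        using fg[of "fst l"] inv_gen[of "fst l"] f.hom_inv[of "g (fst l)"] by simp
      ultimately show ?thesis using False by simp
    qed
    moreover have "f (word_eval G g w) = w"
      using Cons by (auto simp: reduced_Cons)
    ultimately show ?case
      using Cons.prems by (auto simp: f.hom_mult push_reduced)
  qed
  have "bij_betw (word_eval G g) (carrier (free_group X)) (carrier G)"
    using fg gf f word_eval_hom[OF g]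
    by (intro bij_betw_byWitness[where f' = f]) (auto simp: hom_def Pi_iff simp del: free_group_simps)
  then show ?thesis
    using word_eval_hom[OF g] by (auto simp: is_iso_def iso_def)
qed

end

text \<open>The cup product \<open>p \<union> q\<close> of two classes in \<open>H\<^sup>1\<close> of a free group is the coboundary of a
  function \<open>t\<close>; evaluating this on a pair of commuting elements gives the claim.\<close>

lemma free_group_commute:
  fixes p q :: "'a word \<Rightarrow> 'b :: comm_ring_1"
  assumes p: "\<And>v w. v \<in> carrier (free_group X) \<Longrightarrow> w \<in> carrier (free_group X) \<Longrightarrow>
      p (foldr push v w) = p v + p w"
    and q: "\<And>v w. v \<in> carrier (free_group X) \<Longrightarrow> w \<in> carrier (free_group X) \<Longrightarrow>
      q (foldr push v w) = q v + q w"
    and ab: "a \<in> carrier (free_group X)" "b \<in> carrier (free_group X)"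
      "foldr push a b = foldr push b a"
  shows "p a * q b = p b * q a"
proof -
  \<comment> \<open>The relation t(vw) = t(v) + t(w) + p(v) q(w) leaves the values on generators
    free, so 0 is taken. Applied to a letter next to its inverse, it then forces the value p(x) q(x)
    on the inverse of x.\<close>
  define t0 where "t0 l = (if snd l then 0 else p [(fst l, True)] * q [(fst l, True)])" for l
  define t where "t = rec_list 0 (\<lambda>l w r. t0 l + r + p [l] * q w)"
  have t [simp]: "t [] = 0" "t (l # w) = t0 l + t w + p [l] * q w" for l w
    by (simp_all add: t_def)
  have nil: "p [] = 0" "q [] = 0"
    using p[of "[]" "[]"] q[of "[]" "[]"] by simp_all
  have inv: "p [inv_letter l] = - p [l]" "q [inv_letter l] = - q [l]" if "fst l \<in> X" for l
    using p[of "[inv_letter l]" "[l]"] q[of "[inv_letter l]" "[l]"] that nil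
    by (simp_all add: reduced_Cons add_eq_0_iff2)
  have t0: "t0 l + t0 (inv_letter l) = p [l] * q [l]" if "fst l \<in> X" for l
  proof (cases l)
    case (Pair x b)
    then show ?thesis
    proof (cases b)
      case True
      then show ?thesis by (simp add: Pair t0_def inv_letter_def)
    next
      case False
      have "p [(x, False)] = - p [(x, True)]" "q [(x, False)] = - q [(x, True)]"
        using inv[of "(x, True)"] that Pair by (simp_all add: inv_letter_def)
      with False show ?thesis by (simp add: Pair t0_def inv_letter_def)
    qed
  qed
  have cons: "p (l # w) = p [l] + p w" "q (l # w) = q [l] + q w"
    if "l # w \<in> carrier (free_group X)" for l w
    using p[of "[l]" w] q[of "[l]" w] that by (auto simp: reduced_Cons push_reduced)
  \<comment> \<open>Words multiply with cancellation, whereas \<open>t\<close> is a plain recursion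
    over letters. That cancelling a pair does not change \<open>t\<close> is where the value on
    inverse letters enters.\<close>
  have push: "t (push l w) = t (l # w)" if "fst l \<in> X" "w \<in> carrier (free_group X)" for l w
  proof (cases "w \<noteq> [] \<and> hd w = inv_letter l")
    case True
    then obtain w' where w: "w = inv_letter l # w'"
      by (cases w) auto
    have "t (l # w) = t0 l + (t0 (inv_letter l) + t w' + p [inv_letter l] * q w')
        + p [l] * (q [inv_letter l] + q w')"
      using that cons[of "inv_letter l" w'] by (simp add: w)
    also have "\<dots> = (t0 l + t0 (inv_letter l)) - p [l] * q [l] + t w'"
      using that by (simp add: inv algebra_simps)
    also have "\<dots> = t w'" using t0 that by simp
    finally show ?thesis by (simp add: w)
  qed (cases w, auto)
  have mult: "t (foldr push v w) = t v + t w + p v * q w"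
    if "v \<in> carrier (free_group X)" "w \<in> carrier (free_group X)" for v w
    using that
  proof (induction v)
    case (Cons l v)
    interpret group "free_group X" by (rule group_free_group)
    have v: "v \<in> carrier (free_group X)" "fst l \<in> X"
      using Cons.prems by (auto simp: reduced_Cons)
    then have vw: "foldr push v w \<in> carrier (free_group X)"
      using m_closed[OF v(1) Cons.prems(2)] by simp
    have "t (foldr push (l # v) w) = t0 l + t (foldr push v w) + p [l] * q (foldr push v w)"
      using push[OF v(2) vw] by simp
    also have "\<dots> = t (l # v) + t w + p (l # v) * q w"
      using Cons.IH[OF v(1) Cons.prems(2)] q[OF v(1) Cons.prems(2)] cons[OF Cons.prems(1)]
      by (simp add: algebra_simps)
    finally show ?case .
  qed (simp add: nil)
  show ?thesis
    using mult[OF ab(1,2)] mult[OF ab(2,1)] ab(3) by (simp add: algebra_simps)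
qed

text \<open>Serves as an obstruction: values (1, 0) of (p, q) at \<open>a\<close> and (0, 1) at
  \<open>b\<close> would give 1 = 0.\<close>

lemma is_free_group_commute:
  fixes p q :: "'a \<Rightarrow> 'b :: comm_ring_1"
  assumes G: "is_free_group G"
    and p: "\<And>x y. x \<in> carrier G \<Longrightarrow> y \<in> carrier G \<Longrightarrow> p (x \<otimes>\<^bsub>G\<^esub> y) = p x + p y"
    and q: "\<And>x y. x \<in> carrier G \<Longrightarrow> y \<in> carrier G \<Longrightarrow> q (x \<otimes>\<^bsub>G\<^esub> y) = q x + q y"
    and ab: "a \<in> carrier G" "b \<in> carrier G" "a \<otimes>\<^bsub>G\<^esub> b = b \<otimes>\<^bsub>G\<^esub> a"
  shows "p a * q b = p b * q a"
proof -
  obtain X :: "'a set" and h where h: "h \<in> iso (free_group X) G"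
    using G by (auto simp: is_free_group_def is_iso_def)
  then have hom: "h (foldr push v w) = h v \<otimes>\<^bsub>G\<^esub> h w" "h v \<in> carrier G"
    if "v \<in> carrier (free_group X)" "w \<in> carrier (free_group X)" for v w
    using that by (auto simp: iso_def hom_def)
  have bij: "bij_betw h (carrier (free_group X)) (carrier G)"
    using h by (simp add: iso_def)
  obtain v w where vw: "v \<in> carrier (free_group X)" "w \<in> carrier (free_group X)" "a = h v" "b = h w"
    using bij_betw_imp_surj_on[OF bij] ab(1,2) by blast
  interpret F: group "free_group X" by (rule group_free_group)
  have "h (foldr push v w) = h (foldr push w v)"
    using hom(1)[OF vw(1,2)] hom(1)[OF vw(2,1)] ab vw by simp
  moreover have "foldr push v w \<in> carrier (free_group X)" "foldr push w v \<in> carrier (free_group X)"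
    using F.m_closed[OF vw(1,2)] F.m_closed[OF vw(2,1)] by simp_all
  ultimately have comm: "foldr push v w = foldr push w v"
    using bij by (simp add: bij_betw_def inj_on_def)
  have "(p \<circ> h) v * (q \<circ> h) w = (p \<circ> h) w * (q \<circ> h) v"
    by (rule free_group_commute[OF _ _ vw(1,2) comm]) (simp_all add: hom p q del: free_group_simps)
  then show ?thesis by (simp add: vw)
qed

section \<open>Transport along paths\<close>

text \<open>A \<open>local_cocycle\<close> describes a covering space of \<open>S\<close> with fibre \<open>G\<close>; a \<open>development\<close> is a lift
  of a path to this covering.\<close>

locale local_cocycle = group G for G (structure) +
  fixes S :: "'c :: topological_space set" and c :: "'c \<Rightarrow> 'c \<Rightarrow> 'a"
  assumes c_closed [simp]: "x \<in> S \<Longrightarrow> y \<in> S \<Longrightarrow> c x y \<in> carrier G"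
    and c_local: "x \<in> S \<Longrightarrow> \<exists>U. open U \<and> x \<in> U \<and>
      (\<forall>u\<in>U \<inter> S. \<forall>v\<in>U \<inter> S. \<forall>w\<in>U \<inter> S. c u v \<otimes> c v w = c u w)"
begin

definition multiplicative_on :: "'c set \<Rightarrow> bool" where
  "multiplicative_on U \<longleftrightarrow> (\<forall>u\<in>U. \<forall>v\<in>U. \<forall>w\<in>U. c u v \<otimes> c v w = c u w)"

lemma multiplicative_on_subset: "multiplicative_on U \<Longrightarrow> V \<subseteq> U \<Longrightarrow> multiplicative_on V"
  by (force simp: multiplicative_on_def)

lemma c_refl [simp]: "x \<in> S \<Longrightarrow> c x x = \<one>"
  by (metis IntI c_closed c_local r_cancel_one')

definition development :: "(real \<Rightarrow> 'c) \<Rightarrow> real \<Rightarrow> real \<Rightarrow> (real \<Rightarrow> 'a) \<Rightarrow> bool" where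
  "development p a b d \<longleftrightarrow> (\<forall>t\<in>{a..b}. d t \<in> carrier G \<and>
    (\<exists>e>0. \<forall>s\<in>{a..b}. \<bar>s - t\<bar> < e \<longrightarrow> d s = d t \<otimes> c (p t) (p s)))"

lemma development_closed: "development p a b d \<Longrightarrow> t \<in> {a..b} \<Longrightarrow> d t \<in> carrier G"
  by (simp add: development_def)

lemma developmentE:
  assumes "development p a b d" "t \<in> {a..b}"
  obtains e where "e > 0" "\<And>s. s \<in> {a..b} \<Longrightarrow> \<bar>s - t\<bar> < e \<Longrightarrow> d s = d t \<otimes> c (p t) (p s)"
  using assms unfolding development_def by blast

text \<open>Both developments change by the same right factors, which cancel in
  \<open>d t \<otimes> inv d' t\<close>. This quotient is therefore locally constant on an
  interval.\<close>

lemma development_unique: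
  assumes "development p a b d" "development p a b d'" "p ` {a..b} \<subseteq> S"
    and "d a = d' a" "t \<in> {a..b}"
  shows "d t = d' t"
proof -
  have cl: "d s \<in> carrier G" "d' s \<in> carrier G" "p s \<in> S" if "s \<in> {a..b}" for s
    using assms that by (auto intro: development_closed)
  have "d a \<otimes> inv d' a = d t \<otimes> inv d' t"
  proof (rule connected_local_const[where A = "{a..b}"])
    show "\<forall>t\<in>{a..b}. \<forall>\<^sub>F s in at t within {a..b}. d t \<otimes> inv d' t = d s \<otimes> inv d' s"
    proof
      fix t assume t: "t \<in> {a..b}"
      obtain e where e: "e > 0" "\<And>s. s \<in> {a..b} \<Longrightarrow> \<bar>s - t\<bar> < e \<Longrightarrow> d s = d t \<otimes> c (p t) (p s)"
        using developmentE[OF assms(1) t] by blast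
      obtain e' where e': "e' > 0" "\<And>s. s \<in> {a..b} \<Longrightarrow> \<bar>s - t\<bar> < e' \<Longrightarrow> d' s = d' t \<otimes> c (p t) (p s)"
        using developmentE[OF assms(2) t] by blast
      have "d t \<otimes> inv d' t = d s \<otimes> inv d' s" if "s \<in> {a..b}" "\<bar>s - t\<bar> < min e e'" for s
      proof -
        have "c (p t) (p s) \<otimes> (inv c (p t) (p s) \<otimes> inv d' t) = inv d' t"
          using cl[OF t] cl[OF that(1)] by (simp flip: m_assoc)
        then have "(d t \<otimes> c (p t) (p s)) \<otimes> inv (d' t \<otimes> c (p t) (p s)) = d t \<otimes> inv d' t"
          using cl[OF t] cl[OF that(1)] by (simp add: inv_mult_group m_assoc)
        then show ?thesis
          using e(2)[of s] e'(2)[of s] that by simp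
      qed
      then show "\<forall>\<^sub>F s in at t within {a..b}. d t \<otimes> inv d' t = d s \<otimes> inv d' s"
        using e(1) e'(1) by (auto simp: eventually_at dist_real_def intro!: exI[of _ "min e e'"])
    qed
  qed (use assms in auto)
  then have "d t \<otimes> inv d' t = \<one>"
    using assms(4,5) cl[of a] by simp
  then show ?thesis
    using cl[OF assms(5)] by (metis inv_equality inv_inv inv_closed)
qed

lemma development_multiplicative:
  assumes "multiplicative_on (p ` {a..b})" "p ` {a..b} \<subseteq> S" "g \<in> carrier G" "a \<le> b"
  shows "development p a b (\<lambda>t. g \<otimes> c (p a) (p t))"
  unfolding development_def
proof (intro ballI conjI exI[of _ 1] impI)
  fix t assume t: "t \<in> {a..b}"
  have p: "p t \<in> S" "p a \<in> S" using assms t by auto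
  then show "g \<otimes> c (p a) (p t) \<in> carrier G" using assms by simp
  fix s assume s: "s \<in> {a..b}"
  then have "c (p a) (p t) \<otimes> c (p t) (p s) = c (p a) (p s)"
    using assms(1,4) t by (auto simp: multiplicative_on_def)
  moreover have "p s \<in> S" using s assms by auto
  ultimately show "g \<otimes> c (p a) (p s) = g \<otimes> c (p a) (p t) \<otimes> c (p t) (p s)"
    using p assms(3) by (simp add: m_assoc)
qed simp

lemma development_glue:
  assumes d: "development p a b d" "development p b b' d'" "d b = d' b" "a \<le> b" "b \<le> b'"
  shows "development p a b' (\<lambda>t. if t \<le> b then d t else d' t)"
  unfolding development_def
proof (intro ballI conjI)
  let ?D = "\<lambda>t. if t \<le> b then d t else d' t"
  fix t assume t: "t \<in> {a..b'}"
  then show "?D t \<in> carrier G" using d by (auto intro: development_closed)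
  have E1: "\<exists>e>0. \<forall>s\<in>{a..b}. \<bar>s - t\<bar> < e \<longrightarrow> d s = d t \<otimes> c (p t) (p s)" if "t \<le> b"
    using d(1) that t by (auto simp: development_def)
  have E2: "\<exists>e>0. \<forall>s\<in>{b..b'}. \<bar>s - t\<bar> < e \<longrightarrow> d' s = d' t \<otimes> c (p t) (p s)" if "t \<ge> b"
    using d(2) that t by (auto simp: development_def)
  consider "t < b" | "t = b" | "t > b" by linarith
  then show "\<exists>e>0. \<forall>s\<in>{a..b'}. \<bar>s - t\<bar> < e \<longrightarrow> ?D s = ?D t \<otimes> c (p t) (p s)"
  proof cases
    case 1
    then obtain e where "e > 0" "\<And>s. s \<in> {a..b} \<Longrightarrow> \<bar>s - t\<bar> < e \<Longrightarrow> d s = d t \<otimes> c (p t) (p s)"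
      using E1 by auto
    then show ?thesis using 1 by (intro exI[of _ "min e (b - t)"]) auto
  next
    case 2
    obtain e where e: "e > 0" "\<And>s. s \<in> {a..b} \<Longrightarrow> \<bar>s - t\<bar> < e \<Longrightarrow> d s = d t \<otimes> c (p t) (p s)"
      using E1 2 by blast
    obtain e' where e': "e' > 0" "\<And>s. s \<in> {b..b'} \<Longrightarrow> \<bar>s - t\<bar> < e' \<Longrightarrow> d' s = d' t \<otimes> c (p t) (p s)"
      using E2 2 by blast
    have "?D s = ?D t \<otimes> c (p t) (p s)" if "s \<in> {a..b'}" "\<bar>s - t\<bar> < min e e'" for s
      using e(2)[of s] e'(2)[of s] that 2 d(3) by (cases "s \<le> b") auto
    then show ?thesis
      using e(1) e'(1) by (intro exI[of _ "min e e'"]) auto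
  next
    case 3
    then obtain e where "e > 0" "\<And>s. s \<in> {b..b'} \<Longrightarrow> \<bar>s - t\<bar> < e \<Longrightarrow> d' s = d' t \<otimes> c (p t) (p s)"
      using E2 by auto
    then show ?thesis using 3 by (intro exI[of _ "min e (t - b)"]) auto
  qed
qed

text \<open>Bisection: the claim, made for all starting values, passes from two adjacent intervals
  to their union by gluing, and it holds on short intervals because the path stays there in a set on
  which \<open>c\<close> is multiplicative.\<close>

lemma development_exists:
  assumes "continuous_on {a..b} p" "p ` {a..b} \<subseteq> S" "a \<le> b" "g \<in> carrier G"
  shows "\<exists>d. development p a b d \<and> d a = g"
proof -
  have "a \<le> a \<and> b \<le> b \<and> a \<le> b \<longrightarrow> (\<forall>g\<in>carrier G. \<exists>d. development p a b d \<and> d a = g)"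
  proof (rule Bolzano[where P = "\<lambda>u v. a \<le> u \<and> v \<le> b \<and> u \<le> v \<longrightarrow>
        (\<forall>g\<in>carrier G. \<exists>d. development p u v d \<and> d u = g)", OF \<open>a \<le> b\<close>], goal_cases)
    case (1 u v w)
    show ?case
    proof (intro impI ballI)
      fix g assume *: "a \<le> u \<and> w \<le> b \<and> u \<le> w" and g: "g \<in> carrier G"
      obtain d where d: "development p u v d" "d u = g"
        using 1 * g by auto
      then have "d v \<in> carrier G" using 1 by (auto intro: development_closed)
      then obtain d' where "development p v w d'" "d' v = d v"
        using 1 * by auto
      then show "\<exists>d. development p u w d \<and> d u = g"
        using d development_glue[of p u v d w d'] 1
        by (intro exI[of _ "\<lambda>t. if t \<le> v then d t else d' t"]) auto
    qed
  next
    case (2 x)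
    then have x: "p x \<in> S" using assms(2) by auto
    obtain U where U: "open U" "p x \<in> U" "multiplicative_on (U \<inter> S)"
      using c_local[OF x] by (auto simp: multiplicative_on_def)
    have "\<forall>\<^sub>F s in at x within {a..b}. p s \<in> U"
      using assms(1) U 2 by (intro topological_tendstoD[of p "p x"]) (auto simp: continuous_on_def)
    then obtain e where "e > 0" "\<forall>s\<in>{a..b}. s \<noteq> x \<and> \<bar>s - x\<bar> < e \<longrightarrow> p s \<in> U"
      unfolding eventually_at dist_real_def by blast
    then have e: "e > 0" "\<And>s. s \<in> {a..b} \<Longrightarrow> \<bar>s - x\<bar> < e \<Longrightarrow> p s \<in> U"
      using U(2) by metis+
    show ?case
    proof (intro exI[of _ e] conjI allI impI ballI)
      fix u v g assume uv: "u \<le> x \<and> x \<le> v \<and> v - u < e" "a \<le> u \<and> v \<le> b \<and> u \<le> v"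
        and g: "g \<in> carrier G"
      have "p ` {u..v} \<subseteq> U \<inter> S" using uv assms(2) by (auto intro!: e(2))
      then have "development p u v (\<lambda>t. g \<otimes> c (p u) (p t))"
        using U(3) g uv by (intro development_multiplicative) (auto intro: multiplicative_on_subset)
      moreover have "p u \<in> S" using uv assms(2) by auto
      ultimately show "\<exists>d. development p u v d \<and> d u = g"
        using g by (intro exI[of _ "\<lambda>t. g \<otimes> c (p u) (p t)"]) auto
    qed (use e in auto)
  qed
  then show ?thesis using assms by auto
qed

text \<open>The holonomy of the cocycle. For paths in \<open>S\<close> the description is proper, by
  existence and uniqueness of developments.\<close>

definition transport :: "(real \<Rightarrow> 'c) \<Rightarrow> 'a" where
  "transport p = (THE g. \<exists>d. development p 0 1 d \<and> d 0 = \<one> \<and> d 1 = g)"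

lemma transport_eq:
  assumes "development p 0 1 d" "d 0 = \<one>" "path_image p \<subseteq> S"
  shows "transport p = d 1"
  unfolding transport_def
proof (rule the_equality)
  fix g assume "\<exists>d. development p 0 1 d \<and> d 0 = \<one> \<and> d 1 = g"
  then show "g = d 1"
    using development_unique[OF _ assms(1), of _ 1] assms(2,3) by (auto simp: path_image_def)
qed (use assms in auto)

lemma transport_multiplicative:
  assumes "multiplicative_on (path_image p)" "path_image p \<subseteq> S"
  shows "transport p = c (pathstart p) (pathfinish p)"
proof -
  have p: "p 0 \<in> S" "p 1 \<in> S" using assms by (auto simp: path_image_def)
  have "development p 0 1 (\<lambda>t. \<one> \<otimes> c (p 0) (p t))"
    using assms by (intro development_multiplicative) (auto simp: path_image_def)
  then have "transport p = \<one> \<otimes> c (p 0) (p 1)"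
    by (rule transport_eq) (use assms p in auto)
  then show ?thesis using p by (simp add: pathstart_def pathfinish_def)
qed

lemma obtain_development:
  assumes "path p" "path_image p \<subseteq> S"
  obtains d where "development p 0 1 d" "d 0 = \<one>" "d 1 = transport p" "transport p \<in> carrier G"
proof -
  obtain d where d: "development p 0 1 d" "d 0 = \<one>"
    using development_exists[of 0 1 p \<one>] assms by (auto simp: path_def path_image_def)
  moreover have "d 1 \<in> carrier G" using d by (auto intro: development_closed)
  ultimately show ?thesis using that transport_eq[OF d assms(2)] by metis
qed

lemma transport_closed [simp]: "path p \<Longrightarrow> path_image p \<subseteq> S \<Longrightarrow> transport p \<in> carrier G"
  using obtain_development by blast

text \<open>Restricts a development to a subinterval rescaled to the unit interval; the left factor
  \<open>g\<close> resets the starting value. It is meant for the two halves of a joined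
  path.\<close>

lemma development_affine:
  assumes "development p a b d" "k > 0" "\<And>t. t \<in> {0..1} \<Longrightarrow> k * t + m \<in> {a..b}"
    and q: "\<And>t. t \<in> {0..1} \<Longrightarrow> q t = p (k * t + m)"
    and g: "g \<in> carrier G" and "q ` {0..1} \<subseteq> S"
  shows "development q 0 1 (\<lambda>t. g \<otimes> d (k * t + m))"
  unfolding development_def
proof (intro ballI conjI)
  fix t :: real assume t: "t \<in> {0..1}"
  have cl: "d (k * t + m) \<in> carrier G" if "t \<in> {0..1}" for t
    using development_closed[OF assms(1) assms(3)[OF that]] .
  then show "g \<otimes> d (k * t + m) \<in> carrier G" using g t by simp
  obtain e where e: "e > 0" "\<And>s. s \<in> {a..b} \<Longrightarrow> \<bar>s - (k * t + m)\<bar> < e \<Longrightarrow>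
      d s = d (k * t + m) \<otimes> c (p (k * t + m)) (p s)"
    using developmentE[OF assms(1) assms(3)[OF t]] by blast
  have "g \<otimes> d (k * s + m) = g \<otimes> d (k * t + m) \<otimes> c (q t) (q s)"
    if s: "s \<in> {0..1}" "\<bar>s - t\<bar> < e / k" for s
  proof -
    have "\<bar>k * s + m - (k * t + m)\<bar> = k * \<bar>s - t\<bar>"
      using \<open>k > 0\<close> by (simp add: abs_mult flip: right_diff_distrib)
    then have "\<bar>k * s + m - (k * t + m)\<bar> < e"
      using s(2) \<open>k > 0\<close> by (simp add: field_simps)
    then have "d (k * s + m) = d (k * t + m) \<otimes> c (q t) (q s)"
      using e(2)[OF assms(3)[OF s(1)]] q t s by simp
    moreover have "q s \<in> S" "q t \<in> S" using assms(6) s t by auto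
    ultimately show ?thesis using cl[OF t] g by (simp add: m_assoc)
  qed
  then show "\<exists>e>0. \<forall>s\<in>{0..1}. \<bar>s - t\<bar> < e \<longrightarrow>
      g \<otimes> d (k * s + m) = g \<otimes> d (k * t + m) \<otimes> c (q t) (q s)"
    using e(1) \<open>k > 0\<close> by (intro exI[of _ "e / k"]) auto
qed

lemma transport_join:
  assumes "path p" "path_image p \<subseteq> S" "path q" "path_image q \<subseteq> S" "pathfinish p = pathstart q"
  shows "transport (p +++ q) = transport p \<otimes> transport q"
proof -
  have "path (p +++ q)" "path_image (p +++ q) \<subseteq> S"
    using assms by (auto simp: subset_path_image_join)
  then obtain d where d: "development (p +++ q) 0 1 d" "d 0 = \<one>" "d 1 = transport (p +++ q)"
    using obtain_development by metis
  have cl: "d (1/2) \<in> carrier G" "d 1 \<in> carrier G"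
    using development_closed[OF d(1)] by simp_all
  have "development p 0 1 (\<lambda>t. \<one> \<otimes> d (1/2 * t + 0))"
    using d(1) assms
    by (rule_tac development_affine[where p = "p +++ q"]) (auto simp: joinpaths_def path_image_def)
  then have "transport p = \<one> \<otimes> d (1/2 * 1 + 0)"
    by (rule transport_eq) (use d assms in auto)
  moreover have "development q 0 1 (\<lambda>t. inv d (1/2) \<otimes> d (1/2 * t + 1/2))"
    using d(1) assms cl
    by (rule_tac development_affine[where p = "p +++ q"])
      (auto simp: joinpaths_def path_image_def pathfinish_def pathstart_def)
  then have "transport q = inv d (1/2) \<otimes> d (1/2 * 1 + 1/2)"
    by (rule transport_eq) (use d cl assms in auto)
  ultimately show ?thesis
    using cl d by (simp add: m_assoc[symmetric])
qed

text \<open>Nearby rows of the homotopy have equal transport: a development along row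
  \<open>s0\<close>, multiplied on the right by the cocycle from \<open>h (s0, t)\<close> to
  \<open>h (s, t)\<close>, is a development along row \<open>s\<close>. This factor is one at both
  ends, since the end points do not move.\<close>

lemma transport_homotopic:
  assumes "homotopic_paths S p q"
  shows "transport p = transport q"
proof -
  let ?I = "{0..1::real}"
  obtain h where h: "continuous_on (?I \<times> ?I) h" "h \<in> ?I \<times> ?I \<rightarrow> S"
    and h01: "\<forall>x\<in>?I. h (0, x) = p x" "\<forall>x\<in>?I. h (1, x) = q x"
    and ends: "\<forall>t\<in>?I. pathstart (h \<circ> Pair t) = pathstart p \<and> pathfinish (h \<circ> Pair t) = pathfinish p"
    using assms unfolding homotopic_paths by blast
  \<comment> \<open>Open sets on whose images \<open>c\<close> is multiplicative. A Lebesgue number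
    \<open>e\<close> of this cover makes the size of neighbourhoods uniform over the square.\<close>
  define \<G> where "\<G> = {W. open W \<and> multiplicative_on (h ` (W \<inter> (?I \<times> ?I)))}"
  obtain e where e: "e > 0" "\<And>z. z \<in> ?I \<times> ?I \<Longrightarrow> \<exists>W\<in>\<G>. ball z e \<subseteq> W"
  proof (rule Heine_Borel_lemma)
    show "compact (?I \<times> ?I)" by (intro compact_Times) auto
    show "?I \<times> ?I \<subseteq> \<Union>\<G>"
    proof
      fix z assume z: "z \<in> ?I \<times> ?I"
      then have "h z \<in> S" using h by blast
      then obtain U where U: "open U" "h z \<in> U" "multiplicative_on (U \<inter> S)"
        using c_local by (metis multiplicative_on_def)
      obtain W where W: "open W" "W \<inter> (?I \<times> ?I) = h -` U \<inter> (?I \<times> ?I)"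
        using h(1) U(1) unfolding continuous_on_open_invariant by metis
      have "h ` (W \<inter> (?I \<times> ?I)) \<subseteq> U \<inter> S" using W h(2) by auto
      then have "W \<in> \<G>" using W U(3) by (auto simp: \<G>_def intro!: multiplicative_on_subset[OF U(3)])
      moreover have "z \<in> W" using W z U by auto
      ultimately show "z \<in> \<Union>\<G>" by blast
    qed
  qed (auto simp: \<G>_def)
  \<comment> \<open>Less than \<open>e / 2\<close> in each coordinate keeps all three points in the
    ball of radius \<open>e\<close> about the first one.\<close>
  have mult: "c (h (s, t)) (h (s', t')) \<otimes> c (h (s', t')) (h (s'', t'')) = c (h (s, t)) (h (s'', t''))"
    if "s \<in> ?I" "s' \<in> ?I" "s'' \<in> ?I" "t \<in> ?I" "t' \<in> ?I" "t'' \<in> ?I"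
      "\<bar>s' - s\<bar> < e / 2" "\<bar>t' - t\<bar> < e / 2" "\<bar>s'' - s\<bar> < e / 2" "\<bar>t'' - t\<bar> < e / 2"
    for s s' s'' t t' t''
  proof -
    have "(s, t) \<in> ?I \<times> ?I" using that by auto
    then obtain W where W: "W \<in> \<G>" "ball (s, t) e \<subseteq> W" using e(2) by blast
    have "(x, y) \<in> ball (s, t) e" if "\<bar>x - s\<bar> < e / 2" "\<bar>y - t\<bar> < e / 2" for x y
      using that norm_Pair_le[of "s - x" "t - y"] by (simp add: dist_norm abs_minus_commute)
    then have "(s, t) \<in> W" "(s', t') \<in> W" "(s'', t'') \<in> W" using that W(2) e(1) by auto
    then show ?thesis using W(1) that by (auto simp: \<G>_def multiplicative_on_def)
  qed
  have S: "h (s, t) \<in> S" if "s \<in> ?I" "t \<in> ?I" for s t using h(2) that by auto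
  have dev: "\<exists>d. development (\<lambda>t. h (s, t)) 0 1 d \<and> d 0 = \<one> \<and> d 1 = transport (\<lambda>t. h (s, t))"
    if "s \<in> ?I" for s
  proof -
    have "path (\<lambda>t. h (s, t))" unfolding path_def
      using that by (intro continuous_on_compose2[OF h(1)] continuous_intros) auto
    then show ?thesis
      by (rule obtain_development) (use S that in \<open>auto simp: path_image_def\<close>)
  qed
  have near: "transport (\<lambda>t. h (s, t)) = transport (\<lambda>t. h (s0, t))"
    if s0: "s0 \<in> ?I" and s: "s \<in> ?I" and ss: "\<bar>s - s0\<bar> < e / 2" for s s0
  proof -
    obtain d where d: "development (\<lambda>t. h (s0, t)) 0 1 d" "d 0 = \<one>" "d 1 = transport (\<lambda>t. h (s0, t))"
      using dev[OF s0] by blast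
    have cl: "d t \<in> carrier G" if "t \<in> ?I" for t using development_closed[OF d(1) that] .
    have "development (\<lambda>t. h (s, t)) 0 1 (\<lambda>t. d t \<otimes> c (h (s0, t)) (h (s, t)))"
      unfolding development_def
    proof (intro ballI conjI)
      fix t assume t: "t \<in> ?I"
      then show "d t \<otimes> c (h (s0, t)) (h (s, t)) \<in> carrier G" using cl S s0 s by auto
      obtain e' where e': "e' > 0" "\<And>t'. t' \<in> ?I \<Longrightarrow> \<bar>t' - t\<bar> < e' \<Longrightarrow>
          d t' = d t \<otimes> c (h (s0, t)) (h (s0, t'))"
        using developmentE[OF d(1) t] by blast
      have "d t' \<otimes> c (h (s0, t')) (h (s, t')) = d t \<otimes> c (h (s0, t)) (h (s, t)) \<otimes> c (h (s, t)) (h (s, t'))"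
        if t': "t' \<in> ?I" "\<bar>t' - t\<bar> < min e' (e / 2)" for t'
      proof -
        have "d t' \<otimes> c (h (s0, t')) (h (s, t'))
            = d t \<otimes> (c (h (s0, t)) (h (s0, t')) \<otimes> c (h (s0, t')) (h (s, t')))"
          using e'(2)[OF t'(1)] t' cl S s0 s t by (simp add: m_assoc)
        also have "c (h (s0, t)) (h (s0, t')) \<otimes> c (h (s0, t')) (h (s, t')) = c (h (s0, t)) (h (s, t'))"
          using t t' s0 s ss e(1) by (intro mult) auto
        also have "\<dots> = c (h (s0, t)) (h (s, t)) \<otimes> c (h (s, t)) (h (s, t'))"
          using t t' s0 s ss e(1) by (intro mult[symmetric]) auto
        finally show ?thesis using cl S s0 s t t' by (simp add: m_assoc)
      qed
      then show "\<exists>e>0. \<forall>t'\<in>?I. \<bar>t' - t\<bar> < e \<longrightarrow> d t' \<otimes> c (h (s0, t')) (h (s, t'))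
          = d t \<otimes> c (h (s0, t)) (h (s, t)) \<otimes> c (h (s, t)) (h (s, t'))"
        using e' e by (intro exI[of _ "min e' (e / 2)"]) auto
    qed
    moreover have eq: "h (s, 0) = h (s0, 0)" "h (s, 1) = h (s0, 1)"
      using ends s s0 by (auto simp: pathstart_def pathfinish_def)
    ultimately have "transport (\<lambda>t. h (s, t)) = d 1 \<otimes> c (h (s0, 1)) (h (s, 1))"
      using S s s0 d(2) by (intro transport_eq) (auto simp: path_image_def)
    then show ?thesis using eq S s0 cl[of 1] d(3) by simp
  qed
  have "transport (\<lambda>t. h (0, t)) = transport (\<lambda>t. h (1, t))"
  proof (rule connected_local_const[where A = ?I])
    show "\<forall>a\<in>?I. \<forall>\<^sub>F b in at a within ?I. transport (\<lambda>t. h (a, t)) = transport (\<lambda>t. h (b, t))"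
    proof
      fix a assume "a \<in> ?I"
      then have "\<forall>b\<in>?I. b \<noteq> a \<and> \<bar>b - a\<bar> < e / 2 \<longrightarrow> transport (\<lambda>t. h (a, t)) = transport (\<lambda>t. h (b, t))"
        using near[symmetric] by blast
      then show "\<forall>\<^sub>F b in at a within ?I. transport (\<lambda>t. h (a, t)) = transport (\<lambda>t. h (b, t))"
        unfolding eventually_at dist_real_def using e(1) half_gt_zero by blast
    qed
  qed auto
  \<comment> \<open>\<open>p\<close> and \<open>q\<close> agree with the outer rows of
    \<open>h\<close> only on the unit interval; \<open>transport\<close> depends on nothing
    else.\<close>
  moreover have "transport p' = transport q'" if "\<And>t. t \<in> ?I \<Longrightarrow> p' t = q' t" for p' q'
  proof -
    have "development p' 0 1 = development q' 0 1"
      using that by (auto simp: development_def fun_eq_iff)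
    then show ?thesis by (simp add: transport_def)
  qed
  ultimately show ?thesis using h01 by metis
qed

end

section \<open>Homomorphisms out of the fundamental group\<close>

lemma fundamental_group_simps:
  "carrier (fundamental_group S x) = path_class S ` loops_at S x"
  "\<one>\<^bsub>fundamental_group S x\<^esub> = path_class S (\<lambda>_. x)"
  by (simp_all add: fundamental_group_def)

text \<open>Group elements are sets of paths, so a function of paths becomes one of classes by
  evaluation at a chosen member. The choice is immaterial when \<open>F\<close> is homotopy
  invariant.\<close>

definition on_class :: "((real \<Rightarrow> 'a) \<Rightarrow> 'b) \<Rightarrow> (real \<Rightarrow> 'a) set \<Rightarrow> 'b" where
  "on_class F A = F (SOME p. p \<in> A)"

lemma on_class_path_class:
  assumes "p \<in> loops_at S x" "\<And>q. homotopic_paths S p q \<Longrightarrow> F q = F p"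
  shows "on_class F (path_class S p) = F p"
proof -
  have "p \<in> path_class S p"
    using assms(1) by (simp add: path_class_def loops_at_def)
  then have "(SOME q. q \<in> path_class S p) \<in> path_class S p"
    by (rule someI[of "\<lambda>q. q \<in> path_class S p"])
  then show ?thesis
    unfolding on_class_def by (intro assms(2)) (simp add: path_class_def)
qed

lemma on_class_hom:
  fixes S :: "'a :: topological_space set"
  assumes "\<And>p q. homotopic_paths S p q \<Longrightarrow> F p = F q"
    and "\<And>p. p \<in> loops_at S x \<Longrightarrow> F p \<in> carrier G"
    and "\<And>p q. p \<in> loops_at S x \<Longrightarrow> q \<in> loops_at S x \<Longrightarrow> F (p +++ q) = F p \<otimes>\<^bsub>G\<^esub> F q"
  shows "on_class F \<in> hom (fundamental_group S x) G"
proof -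
  have [simp]: "on_class F (path_class S p) = F p" if "p \<in> loops_at S x" for p
    by (rule on_class_path_class[OF that]) (use assms(1) in metis)
  show ?thesis
    by (rule homI) (auto simp: fundamental_group_simps mult_path_class join_in_loops_at assms(2,3))
qed

lemma compose_in_loops_at:
  "p \<in> loops_at S x \<Longrightarrow> continuous_on S f \<Longrightarrow> f ` S \<subseteq> T \<Longrightarrow> f \<circ> p \<in> loops_at T (f x)"
  by (auto simp: loops_at_def path_image_compose pathstart_compose pathfinish_compose
      intro!: path_continuous_image intro: continuous_on_subset)

text \<open>\<open>T\<close> may live in another type, with \<open>g\<close> as its embedding.
  Composition with \<open>g\<close> is injective on classes because \<open>f\<close> undoes it, and
  surjective because \<open>H\<close> deforms every loop into the image of \<open>g\<close>. As
  \<open>H\<close> keeps \<open>x\<close> fixed, this deformation respects end points.\<close>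

lemma fundamental_group_deformation_retract:
  fixes S :: "'a :: topological_space set" and T :: "'b :: topological_space set"
  assumes f: "continuous_on S f" "f ` S \<subseteq> T" and g: "continuous_on T g" "g ` T \<subseteq> S"
    and fg: "\<And>z. z \<in> T \<Longrightarrow> f (g z) = z"
    and H: "continuous_on ({0..1::real} \<times> S) H" "H ` ({0..1} \<times> S) \<subseteq> S"
    and H01: "\<And>y. y \<in> S \<Longrightarrow> H (0, y) = y" "\<And>y. y \<in> S \<Longrightarrow> H (1, y) = g (f y)"
    and Hx: "\<And>t. t \<in> {0..1} \<Longrightarrow> H (t, x) = x" and x: "x \<in> S"
  shows "fundamental_group T (f x) \<cong> fundamental_group S x"
proof -
  have gfx: "g (f x) = x" using H01(2)[OF x] Hx[of 1] by simp
  define h where "h = on_class (\<lambda>p. path_class S (g \<circ> p))"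
  have gS: "g \<circ> p \<in> loops_at S x" if "p \<in> loops_at T (f x)" for p
    using compose_in_loops_at[OF that g] gfx by simp
  have fT: "f \<circ> p \<in> loops_at T (f x)" if "p \<in> loops_at S x" for p
    using compose_in_loops_at[OF that f] .
  have inv: "path_class S (g \<circ> p) = path_class S (g \<circ> q)" if "homotopic_paths T p q" for p q
  proof -
    have "homotopic_paths S (g \<circ> p) (g \<circ> q)"
      using homotopic_paths_continuous_image[OF that g(1)] g(2) by blast
    then show ?thesis
      unfolding path_class_def by (blast intro: homotopic_paths_trans homotopic_paths_sym)
  qed
  have h: "h (path_class T p) = path_class S (g \<circ> p)" if "p \<in> loops_at T (f x)" for p
    unfolding h_def by (rule on_class_path_class[OF that]) (use inv in metis)
  have join: "g \<circ> (p +++ q) = (g \<circ> p) +++ (g \<circ> q)" for p q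
    by (auto simp: joinpaths_def)
  have "h \<in> hom (fundamental_group T (f x)) (fundamental_group S x)"
    unfolding h_def
    by (rule on_class_hom)
      (auto simp: fundamental_group_simps gS join mult_path_class dest: inv)
  moreover have "inj_on h (carrier (fundamental_group T (f x)))"
  proof (rule inj_onI)
    fix A B assume "A \<in> carrier (fundamental_group T (f x))" "B \<in> carrier (fundamental_group T (f x))"
      and eq: "h A = h B"
    then obtain p q where pq: "p \<in> loops_at T (f x)" "q \<in> loops_at T (f x)"
      and AB: "A = path_class T p" "B = path_class T q"
      by (auto simp: fundamental_group_simps)
    have *: "homotopic_paths T p (f \<circ> (g \<circ> p))" if "p \<in> loops_at T (f x)" for p
    proof (rule homotopic_paths_eq)
      fix t :: real assume "t \<in> {0..1}"
      then have "p t \<in> T" using that by (auto simp: loops_at_def path_image_def)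
      then show "p t = (f \<circ> (g \<circ> p)) t" using fg by simp
    qed (use that in \<open>auto simp: loops_at_def\<close>)
    have "homotopic_paths S (g \<circ> p) (g \<circ> q)"
      using eq path_class_eq_iff[OF gS[OF pq(1)]] by (simp add: AB h pq)
    then have "homotopic_paths T (f \<circ> (g \<circ> p)) (f \<circ> (g \<circ> q))"
      using homotopic_paths_continuous_image[OF _ f(1)] f(2) by blast
    then have "homotopic_paths T p q"
      using *[OF pq(1)] *[OF pq(2)] by (blast intro: homotopic_paths_trans homotopic_paths_sym)
    then show "A = B" using path_class_eq_iff[OF pq(1)] AB by blast
  qed
  moreover have "path_class S ` loops_at S x \<subseteq> h ` carrier (fundamental_group T (f x))"
  proof safe
    fix p assume p: "p \<in> loops_at S x"
    have pS: "\<And>t. t \<in> {0..1} \<Longrightarrow> p t \<in> S" "p 0 = x" "p 1 = x" "continuous_on {0..1} p"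
      using p by (auto simp: loops_at_def path_image_def path_def pathstart_def pathfinish_def)
    have "homotopic_paths S p (g \<circ> (f \<circ> p))"
      unfolding homotopic_paths
    proof (intro exI[of _ "\<lambda>(t, u). H (t, p u)"] conjI ballI)
      have "continuous_on ({0..1} \<times> {0..1}) (\<lambda>z. H (fst z, p (snd z)))"
        using pS
        by (intro continuous_on_compose2[OF H(1)] continuous_intros continuous_on_compose2[OF pS(4)]) auto
      then show "continuous_on ({0..1} \<times> {0..1}) (\<lambda>(t, u). H (t, p u))"
        by (simp add: case_prod_beta)
      show "(\<lambda>(t, u). H (t, p u)) \<in> {0..1} \<times> {0..1} \<rightarrow> S"
        using H(2) pS(1) by (auto simp: image_subset_iff)
    qed (use pS H01 Hx in \<open>auto simp: pathstart_def pathfinish_def\<close>)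
    then have "path_class S p = h (path_class T (f \<circ> p))"
      using path_class_eq_iff[OF p] by (simp add: h fT[OF p])
    then show "path_class S p \<in> h ` carrier (fundamental_group T (f x))"
      using fT[OF p] by (auto simp: fundamental_group_simps)
  qed
  moreover have "h ` carrier (fundamental_group T (f x)) \<subseteq> carrier (fundamental_group S x)"
    using \<open>h \<in> hom _ _\<close> unfolding hom_def by blast
  ultimately have "h \<in> iso (fundamental_group T (f x)) (fundamental_group S x)"
    unfolding iso_def bij_betw_def by (simp add: fundamental_group_simps subset_antisym)
  then show ?thesis by (auto simp: is_iso_def)
qed

lemma fundamental_group_homeomorphism:
  fixes S :: "'a :: topological_space set" and T :: "'b :: topological_space set"
  assumes "homeomorphism S T f g" "x \<in> S"
  shows "fundamental_group T (f x) \<cong> fundamental_group S x"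
proof (rule fundamental_group_deformation_retract[where H = snd])
qed (use assms in \<open>auto simp: homeomorphism_def intro!: continuous_intros\<close>)

section \<open>The fundamental groupoid\<close>

text \<open>The pieces of a loop are not loops; following it piece by piece requires classes of
  paths with arbitrary end points.\<close>

definition arrows :: "'a :: real_normed_vector set \<Rightarrow> 'a \<Rightarrow> 'a \<Rightarrow> (real \<Rightarrow> 'a) set set" where
  "arrows S x y = path_class S ` {p. path p \<and> path_image p \<subseteq> S \<and> pathstart p = x \<and> pathfinish p = y}"

text \<open>The same formula as in \<open>fundamental_group\<close>, so that composing arrows from
  the base point to itself is multiplication in the group.\<close>

definition arrow_comp :: "'a :: real_normed_vector set \<Rightarrow> (real \<Rightarrow> 'a) set \<Rightarrow> (real \<Rightarrow> 'a) set \<Rightarrow> (real \<Rightarrow> 'a) set"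
  where "arrow_comp S A B = (\<Union>p\<in>A. \<Union>q\<in>B. path_class S (p +++ q))"

definition arrow_inv :: "'a :: real_normed_vector set \<Rightarrow> (real \<Rightarrow> 'a) set \<Rightarrow> (real \<Rightarrow> 'a) set"
  where "arrow_inv S A = (\<Union>p\<in>A. path_class S (reversepath p))"

lemma mult_fundamental_group: "A \<otimes>\<^bsub>fundamental_group S x\<^esub> B = arrow_comp S A B"
  by (simp add: fundamental_group_def arrow_comp_def)

lemma path_class_eqI: "homotopic_paths S p q \<Longrightarrow> path_class S p = path_class S q"
  unfolding path_class_def by (blast intro: homotopic_paths_trans homotopic_paths_sym)

lemma path_classD: "q \<in> path_class S p \<Longrightarrow> homotopic_paths S p q"
  by (simp add: path_class_def)

context
  fixes S :: "'a :: real_normed_vector set"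
begin

lemma path_class_in_arrows:
  "path p \<Longrightarrow> path_image p \<subseteq> S \<Longrightarrow> pathstart p = x \<Longrightarrow> pathfinish p = y \<Longrightarrow> path_class S p \<in> arrows S x y"
  by (auto simp: arrows_def)

lemma arrowsE:
  assumes "A \<in> arrows S x y"
  obtains p where "path p" "path_image p \<subseteq> S" "pathstart p = x" "pathfinish p = y" "A = path_class S p"
  using assms by (auto simp: arrows_def)

lemma arrow_comp_path_class:
  assumes "path p" "path_image p \<subseteq> S" "path q" "path_image q \<subseteq> S" "pathfinish p = pathstart q"
  shows "arrow_comp S (path_class S p) (path_class S q) = path_class S (p +++ q)"
proof -
  have "path_class S (p' +++ q') = path_class S (p +++ q)"
    if "p' \<in> path_class S p" "q' \<in> path_class S q" for p' q'
    using homotopic_paths_join[OF path_classD[OF that(1)] path_classD[OF that(2)] assms(5)]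
    by (rule path_class_eqI[symmetric])
  moreover have "p \<in> path_class S p" "q \<in> path_class S q"
    using assms by (auto simp: path_class_def)
  ultimately show ?thesis unfolding arrow_comp_def by blast
qed

lemma arrow_inv_path_class:
  assumes "path p" "path_image p \<subseteq> S"
  shows "arrow_inv S (path_class S p) = path_class S (reversepath p)"
proof -
  have "path_class S (reversepath p') = path_class S (reversepath p)" if "p' \<in> path_class S p" for p'
    using path_classD[OF that] by (intro path_class_eqI) (simp add: homotopic_paths_reversepath homotopic_paths_sym)
  moreover have "p \<in> path_class S p"
    using assms by (auto simp: path_class_def)
  ultimately show ?thesis unfolding arrow_inv_def by blast
qed

lemma arrow_comp_closed:
  "A \<in> arrows S x y \<Longrightarrow> B \<in> arrows S y z \<Longrightarrow> arrow_comp S A B \<in> arrows S x z"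
  by (erule arrowsE, erule arrowsE)
    (simp add: arrow_comp_path_class path_class_in_arrows subset_path_image_join)

lemma arrow_inv_closed: "A \<in> arrows S x y \<Longrightarrow> arrow_inv S A \<in> arrows S y x"
  by (erule arrowsE) (auto simp: arrow_inv_path_class intro!: path_class_in_arrows)

lemma arrow_comp_assoc:
  assumes "A \<in> arrows S x y" "B \<in> arrows S y z" "C \<in> arrows S z w"
  shows "arrow_comp S (arrow_comp S A B) C = arrow_comp S A (arrow_comp S B C)"
proof -
  obtain p q r where p: "path p" "path_image p \<subseteq> S" "pathfinish p = y" "A = path_class S p"
    and q: "path q" "path_image q \<subseteq> S" "pathstart q = y" "pathfinish q = z" "B = path_class S q"
    and r: "path r" "path_image r \<subseteq> S" "pathstart r = z" "C = path_class S r"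
    using assms by (metis arrowsE)
  then have "path_class S ((p +++ q) +++ r) = path_class S (p +++ (q +++ r))"
    by (intro path_class_eqI[OF homotopic_paths_sym] homotopic_paths_assoc) auto
  then show ?thesis
    using p q r by (simp add: arrow_comp_path_class subset_path_image_join)
qed

lemma arrow_comp_inv:
  assumes "A \<in> arrows S x y"
  shows "arrow_comp S A (arrow_inv S A) = path_class S (\<lambda>_. x)"
proof -
  obtain p where p: "path p" "path_image p \<subseteq> S" "pathstart p = x" "A = path_class S p"
    using assms by (rule arrowsE)
  then have "path_class S (p +++ reversepath p) = path_class S (linepath x x)"
    using path_class_eqI[OF homotopic_paths_rinv] by metis
  moreover have "linepath x x = (\<lambda>_. x)" by (auto simp: linepath_def algebra_simps)
  ultimately show ?thesis
    using p by (simp add: arrow_comp_path_class arrow_inv_path_class)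
qed

lemma arrow_comp_id:
  assumes "A \<in> arrows S x y"
  shows "arrow_comp S A (path_class S (\<lambda>_. y)) = A" "arrow_comp S (path_class S (\<lambda>_. x)) A = A"
proof -
  obtain p where p: "path p" "path_image p \<subseteq> S" "pathstart p = x" "pathfinish p = y" "A = path_class S p"
    using assms by (rule arrowsE)
  have c: "linepath z z = (\<lambda>_. z)" for z :: 'a by (auto simp: linepath_def algebra_simps)
  have xy: "x \<in> S" "y \<in> S"
    using p by (auto simp: path_image_def pathstart_def pathfinish_def)
  then have comp: "arrow_comp S A (path_class S (linepath y y)) = path_class S (p +++ linepath y y)"
    "arrow_comp S (path_class S (linepath x x)) A = path_class S (linepath x x +++ p)"
    using p by (simp_all add: arrow_comp_path_class)
  show "arrow_comp S A (path_class S (\<lambda>_. y)) = A" "arrow_comp S (path_class S (\<lambda>_. x)) A = A"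
    using comp path_class_eqI[OF homotopic_paths_rid'[OF p(1,2)], of y]
      path_class_eqI[OF homotopic_paths_lid'[OF p(1,2)], of x] p by (simp_all add: c)
qed

lemma arrow_inv_comp:
  assumes "A \<in> arrows S x y"
  shows "arrow_comp S (arrow_inv S A) A = path_class S (\<lambda>_. y)"
proof -
  obtain p where p: "path p" "path_image p \<subseteq> S" "pathfinish p = y" "A = path_class S p"
    using assms by (rule arrowsE)
  then have "arrow_inv S (arrow_inv S A) = A"
    by (simp add: arrow_inv_path_class)
  then show ?thesis
    using arrow_comp_inv[OF arrow_inv_closed[OF assms]] by simp
qed

lemma arrow_inv_comp_distrib:
  assumes "A \<in> arrows S x y" "B \<in> arrows S y z"
  shows "arrow_inv S (arrow_comp S A B) = arrow_comp S (arrow_inv S B) (arrow_inv S A)"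
proof -
  obtain p q where p: "path p" "path_image p \<subseteq> S" "pathfinish p = y" "A = path_class S p"
    and q: "path q" "path_image q \<subseteq> S" "pathstart q = y" "B = path_class S q"
    using assms by (metis arrowsE)
  then show ?thesis
    by (simp add: arrow_comp_path_class arrow_inv_path_class reversepath_joinpaths subset_path_image_join)
qed

lemma arrow_cancel:
  assumes "A \<in> arrows S x y"
  shows "B \<in> arrows S z y \<Longrightarrow> arrow_comp S (arrow_comp S B (arrow_inv S A)) A = B"
    "B \<in> arrows S z x \<Longrightarrow> arrow_comp S (arrow_comp S B A) (arrow_inv S A) = B"
  using assms by (simp_all add: arrow_comp_assoc[OF _ assms arrow_inv_closed[OF assms]]
      arrow_comp_assoc[OF _ arrow_inv_closed[OF assms] assms] arrow_comp_inv arrow_inv_comp arrow_comp_id)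

lemma arrow_simply_connected:
  assumes "simply_connected W" "W \<subseteq> S" "path p" "path_image p \<subseteq> W" "path q" "path_image q \<subseteq> W"
    and "pathstart p = pathstart q" "pathfinish p = pathfinish q"
  shows "path_class S p = path_class S q"
proof -
  have "homotopic_paths W p q"
    using assms unfolding simply_connected_eq_homotopic_paths by metis
  then show ?thesis
    using assms(2) path_class_eqI homotopic_paths_subset by blast
qed

end

lemma (in local_cocycle) on_class_transport:
  "p \<in> loops_at S x \<Longrightarrow> on_class transport (path_class S p) = transport p"
  by (rule on_class_path_class) (auto intro: transport_homotopic[symmetric])

lemma (in local_cocycle) on_class_transport_hom:
  "on_class transport \<in> hom (fundamental_group S x) G"
  by (rule on_class_hom) (auto simp: loops_at_def transport_join intro: transport_homotopic)

section \<open>The plane without finitely many points\<close>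

text \<open>The real line cuts the plane without the points \<open>1, \<dots>, k\<close> into two half planes glued along
  \<open>k + 1\<close> intervals, which \<open>gap\<close> numbers from \<open>0\<close> to \<open>k\<close>. Crossing gap \<open>j\<close> downwards contributes \<open>a j\<close>
  to the cocycle below; gap \<open>0\<close> plays the role of a spanning tree.\<close>

definition punctured_plane :: "nat \<Rightarrow> complex set" where
  "punctured_plane k = - (of_nat ` {1..k})"

definition gap :: "nat \<Rightarrow> real \<Rightarrow> nat" where
  "gap k t = card {j \<in> {1..k}. real j < t}"

lemma gap_le: "gap k t \<le> k"
proof -
  have "card {j \<in> {1..k}. real j < t} \<le> card {1..k}"
    by (rule card_mono) auto
  then show ?thesis by (simp add: gap_def)
qed

text \<open>The punctures to the left of \<open>t\<close> form an initial segment of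
  \<open>{1..k}\<close>, so their number determines them.\<close>

lemma le_gap_iff:
  assumes "j \<in> {1..k}"
  shows "j \<le> gap k t \<longleftrightarrow> real j < t"
proof
  assume "real j < t"
  then have "{1..j} \<subseteq> {i \<in> {1..k}. real i < t}" using assms by auto
  then have "card {1..j} \<le> gap k t" unfolding gap_def by (intro card_mono) auto
  then show "j \<le> gap k t" by simp
next
  assume *: "j \<le> gap k t"
  show "real j < t"
  proof (rule ccontr)
    assume "\<not> real j < t"
    then have "{i \<in> {1..k}. real i < t} \<subseteq> {1..<j}" by auto
    then have "gap k t \<le> card {1..<j}" unfolding gap_def by (intro card_mono) auto
    with * assms show False by (simp, linarith)
  qed
qed

lemma gap_half [simp]: "j \<le> k \<Longrightarrow> gap k (real j + 1 / 2) = j"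
proof -
  assume "j \<le> k"
  then have "{i \<in> {1..k}. real i < real j + 1 / 2} = {1..j}" by auto
  then show ?thesis by (simp add: gap_def)
qed

lemma in_punctured_plane: "z \<in> punctured_plane k \<longleftrightarrow> (\<forall>j\<in>{1..k}. z \<noteq> of_nat j)"
  by (auto simp: punctured_plane_def)

lemma in_punctured_plane_if_Im: "Im z \<noteq> 0 \<Longrightarrow> z \<in> punctured_plane k"
  by (auto simp: in_punctured_plane)

lemma open_punctured_plane: "open (punctured_plane k)"
  unfolding punctured_plane_def by (intro open_Compl finite_imp_closed) auto

lemma i_in_punctured_plane: "\<i> \<in> punctured_plane k"
  by (simp add: in_punctured_plane_if_Im)

lemma gap_eq_if_no_puncture:
  assumes "\<And>r. r \<in> closed_segment s t \<Longrightarrow> of_real r \<in> punctured_plane k"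
  shows "gap k s = gap k t"
proof -
  have "real j < s \<longleftrightarrow> real j < t" if "j \<in> {1..k}" for j
  proof (rule ccontr)
    assume "(real j < s) \<noteq> (real j < t)"
    then have "real j \<in> closed_segment s t" by (auto simp: closed_segment_eq_real_ivl)
    then have "of_real (real j) \<in> punctured_plane k" by (rule assms)
    then show False using that by (auto simp: in_punctured_plane)
  qed
  then show ?thesis unfolding gap_def by (metis (mono_tags, lifting) Collect_cong)
qed

lemma no_puncture_if_gap_eq:
  assumes "gap k s = gap k t" "of_real s \<in> punctured_plane k" "of_real t \<in> punctured_plane k"
    and "r \<in> closed_segment s t"
  shows "complex_of_real r \<in> punctured_plane k"
  unfolding in_punctured_plane
proof (intro ballI notI)
  fix j assume j: "j \<in> {1..k}" and "complex_of_real r = of_nat j"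
  then have r: "r = real j" by (metis of_real_eq_iff of_real_of_nat_eq)
  have "real j \<noteq> s" "real j \<noteq> t"
    using assms(2,3) j by (auto simp: in_punctured_plane)
  moreover have "real j < s \<longleftrightarrow> real j < t"
    using le_gap_iff[OF j] assms(1) by metis
  ultimately show False
    using assms(4) r by (auto simp: closed_segment_eq_real_ivl split: if_splits)
qed

section \<open>The crossing cocycle\<close>

locale crossing = group G for G (structure) +
  fixes k :: nat and a :: "nat \<Rightarrow> 'a"
  assumes a_closed [simp]: "j \<le> k \<Longrightarrow> a j \<in> carrier G" and a_0 [simp]: "a 0 = \<one>"
begin

text \<open>The real axis is counted with the upper half plane, and the gap is read off the point
  that is not strictly below. Only pairs of nearby points matter for developments; for distant ones
  the value has no geometric meaning.\<close>

definition c :: "complex \<Rightarrow> complex \<Rightarrow> 'a" where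
  "c x y = (if Im x \<ge> 0 \<and> Im y < 0 then a (gap k (Re x))
    else if Im x < 0 \<and> Im y \<ge> 0 then inv a (gap k (Re y)) else \<one>)"

lemma c_closed: "c x y \<in> carrier G"
  by (auto simp: c_def gap_le)

text \<open>If all points of \<open>W\<close> on or above the axis see the same gap, then
  \<open>c\<close> is a coboundary on \<open>W\<close>: with \<phi> equal to one on or above the
  axis and to \<open>g\<close> below it, \<open>c u v\<close> is
  \<open>inv \<phi> u \<otimes> \<phi> v\<close>.\<close>

lemma c_mult:
  assumes "\<And>x y. x \<in> W \<Longrightarrow> y \<in> W \<Longrightarrow> Im x \<ge> 0 \<Longrightarrow> Im y \<ge> 0 \<Longrightarrow> gap k (Re x) = gap k (Re y)"
    and "x \<in> W" "y \<in> W" "z \<in> W"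
  shows "c x y \<otimes> c y z = c x z"
proof -
  obtain g where g: "g \<in> carrier G" "\<And>w. w \<in> W \<Longrightarrow> Im w \<ge> 0 \<Longrightarrow> a (gap k (Re w)) = g"
  proof (cases "\<exists>w\<in>W. Im w \<ge> 0")
    case True
    then obtain w where w: "w \<in> W" "Im w \<ge> 0" by blast
    show ?thesis
    proof (rule that)
      show "a (gap k (Re w)) \<in> carrier G" by (simp add: gap_le)
      show "a (gap k (Re v)) = a (gap k (Re w))" if "v \<in> W" "Im v \<ge> 0" for v
        using assms(1)[OF that(1) w(1) that(2) w(2)] by (rule arg_cong)
    qed
  qed (use that in blast)
  have c_eq: "c u v = (if Im u \<ge> 0 \<and> Im v < 0 then g else if Im u < 0 \<and> Im v \<ge> 0 then inv g else \<one>)"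
    if "u \<in> W" "v \<in> W" for u v
    unfolding c_def using g(2)[OF that(1)] g(2)[OF that(2)] by (intro if_cong) auto
  show ?thesis
    unfolding c_eq[OF assms(2,3)] c_eq[OF assms(3,4)] c_eq[OF assms(2,4)] using g(1) by auto
qed

lemma c_upper: "Im x \<ge> 0 \<Longrightarrow> Im y \<ge> 0 \<Longrightarrow> c x y = \<one>"
  by (simp add: c_def)

sublocale local_cocycle G "punctured_plane k" c
proof
  fix x assume x: "x \<in> punctured_plane k"
  obtain r where r: "r > 0" "ball x r \<subseteq> punctured_plane k"
    using open_punctured_plane x by (meson open_contains_ball)
  show "\<exists>U. open U \<and> x \<in> U \<and> (\<forall>u\<in>U \<inter> punctured_plane k. \<forall>v\<in>U \<inter> punctured_plane k.
      \<forall>w\<in>U \<inter> punctured_plane k. c u v \<otimes> c v w = c u w)"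
  proof (cases "Im x > 0")
    case True
    then show ?thesis
      by (intro exI[of _ "{z. Im z > 0}"]) (auto simp: c_def open_halfspace_Im_gt)
  next
    case nonpos: False
    show ?thesis
    proof (cases "Im x < 0")
      case True
      then show ?thesis
        by (intro exI[of _ "{z. Im z < 0}"]) (auto simp: c_def open_halfspace_Im_lt)
    next
      case False
      with nonpos have Im: "Im x = 0" by simp
      then have x_eq: "x = of_real (Re x)" by (simp add: complex_eq_iff)
      \<comment> \<open>The centre is real, so real parts of points of the ball lie in the ball
        again, and no puncture separates them.\<close>
      have "gap k (Re u) = gap k (Re v)" if "u \<in> ball x r" "v \<in> ball x r" for u v
      proof (rule gap_eq_if_no_puncture)
        fix t assume t: "t \<in> closed_segment (Re u) (Re v)"
        have "Re u \<in> ball (Re x) r" "Re v \<in> ball (Re x) r"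
          using that abs_Re_le_cmod[of "x - u"] abs_Re_le_cmod[of "x - v"]
          by (auto simp: dist_norm)
        then have "t \<in> ball (Re x) r"
          using t closed_segment_subset[OF _ _ convex_ball] by blast
        then have "of_real t \<in> ball x r"
          by (subst x_eq) (simp add: dist_of_real)
        then show "of_real t \<in> punctured_plane k" using r(2) by blast
      qed
      then have "c u v \<otimes> c v w = c u w" if "u \<in> ball x r" "v \<in> ball x r" "w \<in> ball x r" for u v w
        using that by (intro c_mult[of "ball x r"]) blast+
      then show ?thesis
        using r(1) by (intro exI[of _ "ball x r"]) simp
    qed
  qed
qed (rule c_closed)

end

section \<open>Generating loops and the two closed half planes\<close>

definition gap_point :: "nat \<Rightarrow> complex" where
  "gap_point j = of_real (real j + 1 / 2)"

text \<open>Down through gap \<open>j\<close> and back up through gap 0. For j between 1 and k this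
  runs once clockwise around the punctures 1, ..., j. It is not the usual loop around a single
  puncture, but its transport is the single factor \<open>a j\<close>.\<close>

definition gap_loop :: "nat \<Rightarrow> real \<Rightarrow> complex" where
  "gap_loop j = (linepath \<i> (gap_point j) +++ linepath (gap_point j) (- \<i>)) +++
     (linepath (- \<i>) (gap_point 0) +++ linepath (gap_point 0) \<i>)"

lemma gap_point_simps [simp]: "Re (gap_point j) = real j + 1 / 2" "Im (gap_point j) = 0"
  by (simp_all add: gap_point_def)

lemma gap_point_in: "gap_point j \<in> punctured_plane k"
  unfolding in_punctured_plane
proof (intro ballI notI)
  fix i assume "gap_point j = of_nat i"
  then have "real j + 1 / 2 = real i" by (metis gap_point_simps(1) complex_Re_of_nat)
  then have "real (2 * j + 1) = real (2 * i)" by simp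
  then show False by (metis of_nat_eq_iff even_plus_one_iff dvd_triv_left)
qed

definition upper_part :: "nat \<Rightarrow> complex set" where
  "upper_part k = {z \<in> punctured_plane k. Im z \<ge> 0}"

definition lower_part :: "nat \<Rightarrow> complex set" where
  "lower_part k = {z \<in> punctured_plane k. Im z \<le> 0}"

text \<open>The segment starts at height 1, so all its points except possibly \<open>z\<close> lie
  strictly above the axis. Hence the closed half plane stays star-shaped when the punctures on its
  boundary are removed.\<close>

lemma closed_segment_upper:
  assumes "z \<in> upper_part k"
  shows "closed_segment \<i> z \<subseteq> upper_part k"
proof
  fix w assume "w \<in> closed_segment \<i> z"
  then obtain u where u: "0 \<le> u" "u \<le> 1" "w = (1 - u) *\<^sub>R \<i> + u *\<^sub>R z"
    by (auto simp: closed_segment_def)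
  have Im: "Im w = (1 - u) + u * Im z" by (simp add: u)
  show "w \<in> upper_part k"
  proof (cases "u = 1")
    case False
    then have "Im w > 0"
      using u assms by (auto simp: Im upper_part_def intro!: add_pos_nonneg)
    then show ?thesis by (simp add: upper_part_def in_punctured_plane_if_Im)
  qed (use assms u in auto)
qed

lemma closed_segment_lower:
  assumes "z \<in> lower_part k"
  shows "closed_segment (- \<i>) z \<subseteq> lower_part k"
proof
  fix w assume "w \<in> closed_segment (- \<i>) z"
  then obtain u where u: "0 \<le> u" "u \<le> 1" "w = (1 - u) *\<^sub>R (- \<i>) + u *\<^sub>R z"
    by (auto simp: closed_segment_def)
  have Im: "- Im w = (1 - u) + u * (- Im z)" by (simp add: u)
  show "w \<in> lower_part k"
  proof (cases "u = 1")
    case False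
    then have "- Im w > 0"
      unfolding Im using u assms by (intro add_pos_nonneg mult_nonneg_nonneg) (auto simp: lower_part_def)
    then show ?thesis by (simp add: lower_part_def in_punctured_plane_if_Im)
  qed (use assms u in auto)
qed

lemma parts_subset: "upper_part k \<subseteq> punctured_plane k" "lower_part k \<subseteq> punctured_plane k"
  by (auto simp: upper_part_def lower_part_def)

lemma simply_connected_upper: "simply_connected (upper_part k)"
proof -
  have "\<i> \<in> upper_part k" by (simp add: upper_part_def i_in_punctured_plane)
  then show ?thesis
    using closed_segment_upper by (intro starlike_imp_simply_connected) (auto simp only: starlike_def)
qed

lemma simply_connected_lower: "simply_connected (lower_part k)"
proof -
  have "- \<i> \<in> lower_part k" by (simp add: lower_part_def in_punctured_plane_if_Im)
  then show ?thesis
    using closed_segment_lower by (intro starlike_imp_simply_connected) (auto simp only: starlike_def)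
qed

lemma gap_point_parts: "gap_point j \<in> upper_part k" "gap_point j \<in> lower_part k"
  using gap_point_in by (auto simp: upper_part_def lower_part_def)

lemma gap_loop_in_loops: "gap_loop j \<in> loops_at (punctured_plane k) \<i>"
proof -
  have "closed_segment \<i> (gap_point j) \<subseteq> punctured_plane k"
    "closed_segment (- \<i>) (gap_point j) \<subseteq> punctured_plane k" for j
    using closed_segment_upper closed_segment_lower gap_point_parts parts_subset by blast+
  then show ?thesis
    by (auto simp: loops_at_def gap_loop_def closed_segment_commute path_image_join)
qed

lemma (in crossing) transport_gap_loop:
  assumes "j \<le> k"
  shows "transport (gap_loop j) = a j"
proof -
  let ?X = "punctured_plane k"
  have seg: "closed_segment \<i> (gap_point i) \<subseteq> upper_part k"
    "closed_segment (- \<i>) (gap_point i) \<subseteq> lower_part k" for i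
    using closed_segment_upper closed_segment_lower gap_point_parts by blast+
  then have segX: "closed_segment \<i> (gap_point i) \<subseteq> ?X" "closed_segment (gap_point i) \<i> \<subseteq> ?X"
    "closed_segment (- \<i>) (gap_point i) \<subseteq> ?X" "closed_segment (gap_point i) (- \<i>) \<subseteq> ?X" for i
    using parts_subset by (metis closed_segment_commute subset_trans)+
  have up: "multiplicative_on (closed_segment \<i> (gap_point i))" for i
    using seg(1)[of i] unfolding multiplicative_on_def by (auto simp: c_def upper_part_def subset_iff)
  \<comment> \<open>A segment rising from \<open>- \<i>\<close> meets the closed upper half plane
    only at its end, so only one gap is involved and \<open>c\<close> is multiplicative on
    it.\<close>
  have gp: "w = gap_point i" if "w \<in> closed_segment (- \<i>) (gap_point i)" "Im w \<ge> 0" for w i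
  proof -
    obtain u where u: "0 \<le> u" "u \<le> 1" "w = (1 - u) *\<^sub>R (- \<i>) + u *\<^sub>R gap_point i"
      using \<open>w \<in> _\<close> by (auto simp: closed_segment_def)
    then have "u = 1" using \<open>Im w \<ge> 0\<close> by simp
    then show ?thesis using u by simp
  qed
  have down: "multiplicative_on (closed_segment (- \<i>) (gap_point i))" for i
    unfolding multiplicative_on_def
  proof (intro ballI c_mult[of "closed_segment (- \<i>) (gap_point i)"])
    fix x y assume "x \<in> closed_segment (- \<i>) (gap_point i)" "y \<in> closed_segment (- \<i>) (gap_point i)"
      "Im x \<ge> 0" "Im y \<ge> 0"
    then show "gap k (Re x) = gap k (Re y)" using gp by metis
  qed
  have "transport (linepath \<i> (gap_point j)) = \<one>"
    using up[of j] segX by (subst transport_multiplicative) (auto simp: c_upper)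
  moreover have "transport (linepath (gap_point j) (- \<i>)) = a j"
    using down[of j] segX assms
    by (subst transport_multiplicative) (auto simp: c_def closed_segment_commute)
  \<comment> \<open>This upward crossing contributes the inverse of \<open>a 0\<close>, which is
    one.\<close>
  moreover have "transport (linepath (- \<i>) (gap_point 0)) = \<one>"
    using down[of 0] segX gap_half[of 0 k]
    by (subst transport_multiplicative) (auto simp: c_def)
  moreover have "transport (linepath (gap_point 0) \<i>) = \<one>"
    using up[of 0] segX by (subst transport_multiplicative) (auto simp: c_upper closed_segment_commute)
  ultimately show ?thesis
    using segX assms by (simp add: gap_loop_def transport_join subset_path_image_join)
qed

lemma carrier_eq_arrows: "carrier (fundamental_group S x) = arrows S x x"
  by (auto simp: fundamental_group_simps arrows_def loops_at_def)

section \<open>Reference arrows and transport in the fundamental group\<close>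

locale punctured_plane_groupoid =
  fixes k :: nat
begin

abbreviation (input) "X \<equiv> punctured_plane k"

abbreviation comp (infixl "\<star>" 70) where "A \<star> B \<equiv> arrow_comp X A B"

abbreviation "from_i w \<equiv> path_class X (linepath \<i> w)"

abbreviation "from_mi w \<equiv> path_class X (linepath (- \<i>) w)"

definition crossing_class :: "(real \<Rightarrow> complex) set" where
  "crossing_class = from_i (gap_point 0) \<star> arrow_inv X (from_mi (gap_point 0))"

text \<open>Reference arrows along a spanning tree: the lower half plane is entered through gap 0
  only. Real points are reached from above, matching the convention for \<open>c\<close>.\<close>

definition spoke :: "complex \<Rightarrow> (real \<Rightarrow> complex) set" where
  "spoke w = (if Im w \<ge> 0 then from_i w else crossing_class \<star> from_mi w)"

lemma from_i_arrow: "w \<in> upper_part k \<Longrightarrow> from_i w \<in> arrows X \<i> w"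
  using closed_segment_upper[of w k] parts_subset[of k] by (intro path_class_in_arrows) auto

lemma from_mi_arrow: "w \<in> lower_part k \<Longrightarrow> from_mi w \<in> arrows X (- \<i>) w"
  using closed_segment_lower[of w k] parts_subset[of k] by (intro path_class_in_arrows) auto

lemma crossing_class_arrow: "crossing_class \<in> arrows X \<i> (- \<i>)"
  unfolding crossing_class_def
  using from_i_arrow[OF gap_point_parts(1)] from_mi_arrow[OF gap_point_parts(2)]
  by (blast intro: arrow_comp_closed arrow_inv_closed)

lemma spoke_arrow: "w \<in> X \<Longrightarrow> spoke w \<in> arrows X \<i> w"
  by (auto simp: spoke_def upper_part_def lower_part_def
      intro!: from_i_arrow from_mi_arrow arrow_comp_closed[OF crossing_class_arrow])

lemma from_i_step:
  assumes "path q" "path_image q \<subseteq> upper_part k" "pathstart q = z" "pathfinish q = y"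
  shows "from_i z \<star> path_class X q = from_i y"
proof -
  have zy: "z \<in> upper_part k" "y \<in> upper_part k"
    using assms pathstart_in_path_image[of q] pathfinish_in_path_image[of q] by auto
  note seg = closed_segment_upper[OF zy(1)] closed_segment_upper[OF zy(2)]
  have "from_i z \<star> path_class X q = path_class X (linepath \<i> z +++ q)"
    using assms seg parts_subset[of k] by (intro arrow_comp_path_class) auto
  also have "\<dots> = from_i y"
    by (rule arrow_simply_connected[OF simply_connected_upper parts_subset(1)])
      (use assms seg in \<open>simp_all add: subset_path_image_join\<close>)
  finally show ?thesis .
qed

lemma from_mi_step:
  assumes "path q" "path_image q \<subseteq> lower_part k" "pathstart q = z" "pathfinish q = y"
  shows "from_mi z \<star> path_class X q = from_mi y"
proof -
  have zy: "z \<in> lower_part k" "y \<in> lower_part k"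
    using assms pathstart_in_path_image[of q] pathfinish_in_path_image[of q] by auto
  note seg = closed_segment_lower[OF zy(1)] closed_segment_lower[OF zy(2)]
  have "from_mi z \<star> path_class X q = path_class X (linepath (- \<i>) z +++ q)"
    using assms seg parts_subset[of k] by (intro arrow_comp_path_class) auto
  also have "\<dots> = from_mi y"
    by (rule arrow_simply_connected[OF simply_connected_lower parts_subset(2)])
      (use assms seg in \<open>simp_all add: subset_path_image_join\<close>)
  finally show ?thesis .
qed

lemma gap_loop_class:
  "path_class X (gap_loop j) =
    from_i (gap_point j) \<star> arrow_inv X (from_mi (gap_point j)) \<star> arrow_inv X crossing_class"
proof -
  have seg: "closed_segment \<i> (gap_point i) \<subseteq> X" "closed_segment (- \<i>) (gap_point i) \<subseteq> X" for i
    using closed_segment_upper closed_segment_lower gap_point_parts parts_subset by blast+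
  then have seg': "closed_segment (gap_point i) \<i> \<subseteq> X" "closed_segment (gap_point i) (- \<i>) \<subseteq> X" for i
    by (metis closed_segment_commute)+
  show ?thesis
    using seg seg'
    by (simp add: gap_loop_def crossing_class_def arrow_inv_path_class arrow_comp_path_class
        subset_path_image_join reversepath_joinpaths)
qed

lemma gap_loop_class_0: "path_class X (gap_loop 0) = \<one>\<^bsub>fundamental_group X \<i>\<^esub>"
  using arrow_comp_inv[OF crossing_class_arrow]
  by (simp add: gap_loop_class fundamental_group_simps flip: crossing_class_def)

text \<open>A real point can slid within its gap to the chosen point there without changing the
  class, since the sliding path and its inverse cancel. Crossings at arbitrary real points are thus
  reduced to the finitely many loops \<open>gap_loop j\<close>.\<close>

lemma gap_loop_class_real:
  assumes "z \<in> X" "Im z = 0"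
  shows "from_i z \<star> arrow_inv X (from_mi z) = from_i (gap_point (gap k (Re z))) \<star>
    arrow_inv X (from_mi (gap_point (gap k (Re z))))"
proof -
  let ?g = "gap_point (gap k (Re z))"
  let ?e = "path_class X (linepath ?g z)"
  have z: "z = of_real (Re z)" by (simp add: complex_eq_iff assms)
  have "closed_segment ?g z \<subseteq> upper_part k \<inter> lower_part k"
  proof
    fix w assume "w \<in> closed_segment ?g z"
    then have "w \<in> of_real ` closed_segment (real (gap k (Re z)) + 1 / 2) (Re z)"
      by (subst (asm) z) (simp only: gap_point_def closed_segment_of_real)
    then obtain r where r: "r \<in> closed_segment (real (gap k (Re z)) + 1 / 2) (Re z)" "w = of_real r"
      by blast
    have "of_real r \<in> X"
    proof (rule no_puncture_if_gap_eq[OF _ _ _ r(1)])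
      show "of_real (real (gap k (Re z)) + 1 / 2) \<in> X"
        using gap_point_in by (simp only: gap_point_def)
      show "of_real (Re z) \<in> X" using assms(1) z by simp
    qed (simp add: gap_le)
    then show "w \<in> upper_part k \<inter> lower_part k"
      using r by (simp add: upper_part_def lower_part_def)
  qed
  then have e: "path_image (linepath ?g z) \<subseteq> upper_part k" "path_image (linepath ?g z) \<subseteq> lower_part k"
    by auto
  have earr: "?e \<in> arrows X ?g z"
    using e parts_subset[of k] by (intro path_class_in_arrows) auto
  note U = from_i_arrow[OF gap_point_parts(1)[of "gap k (Re z)"]]
    and L = from_mi_arrow[OF gap_point_parts(2)[of "gap k (Re z)"]]
  have "from_i z = from_i ?g \<star> ?e" "from_mi z = from_mi ?g \<star> ?e"
    using from_i_step[OF _ e(1), of ?g z] from_mi_step[OF _ e(2), of ?g z] by simp_all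
  then have "from_i z \<star> arrow_inv X (from_mi z)
      = (from_i ?g \<star> ?e) \<star> (arrow_inv X ?e \<star> arrow_inv X (from_mi ?g))"
    by (simp add: arrow_inv_comp_distrib[OF L earr])
  also have "\<dots> = from_i ?g \<star> ?e \<star> arrow_inv X ?e \<star> arrow_inv X (from_mi ?g)"
    using arrow_comp_assoc[OF arrow_comp_closed[OF U earr] arrow_inv_closed[OF earr] arrow_inv_closed[OF L]]
    by simp
  also have "\<dots> = from_i ?g \<star> arrow_inv X (from_mi ?g)"
    by (simp add: arrow_cancel(2)[OF earr U])
  finally show ?thesis .
qed

text \<open>The cocycle with values in the fundamental group itself. The condition on gap 0 holds
  because \<open>gap_loop 0\<close> returns the way it came.\<close>

sublocale pi1: crossing "fundamental_group X \<i>" k "\<lambda>j. path_class X (gap_loop j)"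
proof -
  interpret group "fundamental_group X \<i>"
    by (rule group_fundamental_group[OF i_in_punctured_plane])
  show "crossing (fundamental_group X \<i>) k (\<lambda>j. path_class X (gap_loop j))"
    by unfold_locales (auto simp: gap_loop_class_0 fundamental_group_simps gap_loop_in_loops)
qed

text \<open>The cocycle measures how far the reference arrows are from being compatible with short
  paths. Bounding \<open>r\<close> by the height of a nonreal \<open>z\<close> leaves three
  situations: both points on or above the axis, both strictly below it, or \<open>z\<close> real and
  \<open>y\<close> below.\<close>

lemma spoke_step:
  assumes z: "z \<in> X" and y: "y \<in> ball z r" and r: "ball z r \<subseteq> X" "Im z \<noteq> 0 \<Longrightarrow> r \<le> \<bar>Im z\<bar>"
    and q: "path q" "path_image q \<subseteq> ball z r" "pathstart q = z" "pathfinish q = y"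
  shows "spoke z \<star> path_class X q \<star> arrow_inv X (spoke y) = pi1.c z y"
proof -
  have yX: "y \<in> X" using y r by blast
  have r_pos: "r > 0" using y by (metis ball_eq_empty empty_iff not_le)
  have seg: "closed_segment z y \<subseteq> ball z r"
    using y r_pos by (intro closed_segment_subset) auto
  have q_arrow: "path_class X q \<in> arrows X z y"
    using q r by (intro path_class_in_arrows) auto
  have q_eq: "path_class X q = path_class X (linepath z y)"
    using q seg by (intro arrow_simply_connected[OF convex_imp_simply_connected[OF convex_ball] r(1)]) auto
  have segX: "path (linepath z y)" "path_image (linepath z y) \<subseteq> X" using seg r(1) by auto
  have Im_dist: "\<bar>Im z - Im y\<bar> < r"
    using y abs_Im_le_cmod[of "z - y"] by (simp add: dist_norm)
  have Im_seg: "\<exists>u\<ge>0. u \<le> 1 \<and> Im w = (1 - u) * Im z + u * Im y" if "w \<in> closed_segment z y" for w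
    using that by (auto simp: closed_segment_def)
  note D = crossing_class_arrow
  consider (up) "Im z \<ge> 0" "Im y \<ge> 0" | (down) "Im z < 0" "Im y < 0" | (cross) "Im z = 0" "Im y < 0"
    using Im_dist r(2) by linarith
  then show ?thesis
  proof cases
    case up
    have "path_image (linepath z y) \<subseteq> upper_part k"
      using up Im_seg segX(2) by (fastforce simp: upper_part_def)
    then have "from_i z \<star> path_class X q = from_i y"
      using from_i_step[of "linepath z y" z y] q_eq by simp
    moreover have "from_i y \<star> arrow_inv X (from_i y) = path_class X (\<lambda>_. \<i>)"
      using up yX by (intro arrow_comp_inv[OF from_i_arrow]) (simp add: upper_part_def)
    ultimately show ?thesis
      using up by (simp add: spoke_def pi1.c_def fundamental_group_simps)
  next
    case down
    have neg: "(1 - u) * Im z + u * Im y \<le> 0" if "0 \<le> u" "u \<le> 1" for u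
      using down that by (intro add_nonpos_nonpos mult_nonneg_nonpos) auto
    have "path_image (linepath z y) \<subseteq> lower_part k"
      using Im_seg segX(2) neg by (fastforce simp: lower_part_def)
    then have "from_mi z \<star> path_class X q = from_mi y"
      using from_mi_step[of "linepath z y" z y] q_eq by simp
    moreover have "from_mi z \<in> arrows X (- \<i>) z"
      using down z by (intro from_mi_arrow) (simp add: lower_part_def)
    ultimately have "spoke z \<star> path_class X q = spoke y"
      using down arrow_comp_assoc[OF D _ q_arrow] by (simp add: spoke_def)
    moreover have "spoke y \<star> arrow_inv X (spoke y) = path_class X (\<lambda>_. \<i>)"
      by (rule arrow_comp_inv[OF spoke_arrow[OF yX]])
    ultimately show ?thesis
      using down by (simp add: pi1.c_def fundamental_group_simps)
  next
    case cross
    have neg: "u * Im y \<le> 0" if "0 \<le> u" for u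
      using cross that by (intro mult_nonneg_nonpos) auto
    have "path_image (linepath z y) \<subseteq> lower_part k"
      using Im_seg segX(2) neg cross by (fastforce simp: lower_part_def)
    then have step: "from_mi z \<star> path_class X q = from_mi y"
      using from_mi_step[of "linepath z y" z y] q_eq by simp
    have L: "from_mi z \<in> arrows X (- \<i>) z" and U: "from_i z \<in> arrows X \<i> z"
      using cross z by (auto intro!: from_mi_arrow from_i_arrow simp: lower_part_def upper_part_def)
    let ?A = "from_i z \<star> arrow_inv X (from_mi z)"
    note L' = arrow_inv_closed[OF L] and A = arrow_comp_closed[OF U arrow_inv_closed[OF L]]
      and Lq = arrow_comp_closed[OF L q_arrow] and D' = arrow_inv_closed[OF D]
    \<comment> \<open>A detour from \<open>z\<close> to \<open>- \<i>\<close> and back is inserted,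
      so that \<open>q\<close> can be absorbed into \<open>from_mi\<close> within the lower half
      plane.\<close>
    have "from_i z \<star> path_class X q = (?A \<star> from_mi z) \<star> path_class X q"
      by (simp add: arrow_cancel(1)[OF L U])
    also have "\<dots> = ?A \<star> from_mi y"
      by (simp add: arrow_comp_assoc[OF A L q_arrow] step)
    finally have "from_i z \<star> path_class X q = ?A \<star> from_mi y" .
    moreover have "arrow_inv X (spoke y) = arrow_inv X (from_mi y) \<star> arrow_inv X crossing_class"
      using cross arrow_inv_comp_distrib[OF D Lq] step by (simp add: spoke_def)
    moreover have "?A \<star> from_mi y \<star> (arrow_inv X (from_mi y) \<star> arrow_inv X crossing_class)
        = ?A \<star> arrow_inv X crossing_class"
    proof -
      have y': "from_mi y \<in> arrows X (- \<i>) y" using Lq step by simp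
      show ?thesis
        using arrow_comp_assoc[OF arrow_comp_closed[OF A y'] arrow_inv_closed[OF y'] D']
        by (simp add: arrow_cancel(2)[OF y' A])
    qed
    moreover have "pi1.c z y = path_class X (gap_loop (gap k (Re z)))"
      using cross by (simp add: pi1.c_def)
    moreover have "spoke z = from_i z" using cross by (simp add: spoke_def)
    ultimately show ?thesis
      using gap_loop_class[of "gap k (Re z)"] gap_loop_class_real[OF z cross(1)] by simp
  qed
qed

text \<open>The class of \<open>p\<close> up to time \<open>t\<close>, followed by the inverse
  reference arrow at \<open>p t\<close>, is a development: its local condition is
  \<open>spoke_step\<close>. At both ends the reference arrow is constant, so this development leads
  from one to the class of \<open>p\<close>.\<close>

lemma transport_eq_path_class:
  assumes "p \<in> loops_at X \<i>"
  shows "pi1.transport p = path_class X p"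
proof -
  have p: "path p" "path_image p \<subseteq> X" "p 0 = \<i>" "p 1 = \<i>"
    using assms by (auto simp: loops_at_def pathstart_def pathfinish_def)
  have pX: "p t \<in> X" if "t \<in> {0..1}" for t using p that by (auto simp: path_image_def)
  define d where "d t = path_class X (subpath 0 t p) \<star> arrow_inv X (spoke (p t))" for t
  have sub: "path_class X (subpath u v p) \<in> arrows X (p u) (p v)" if "u \<in> {0..1}" "v \<in> {0..1}" for u v
    using that p path_image_subpath_subset[of u v p]
    by (intro path_class_in_arrows) (auto simp: pathstart_subpath pathfinish_subpath)
  have spoke_p: "spoke (p t) \<in> arrows X \<i> (p t)" if "t \<in> {0..1}" for t
    using spoke_arrow pX that by blast
  have "pi1.development p 0 1 d"
    unfolding pi1.development_def
  proof (intro ballI conjI)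
    fix t :: real assume t: "t \<in> {0..1}"
    show "d t \<in> carrier (fundamental_group X \<i>)"
      using arrow_comp_closed[OF sub[of 0 t] arrow_inv_closed[OF spoke_p[OF t]]] t p
      by (simp add: d_def carrier_eq_arrows)
    obtain r0 where r0: "r0 > 0" "ball (p t) r0 \<subseteq> X"
      using pX[OF t] open_punctured_plane by (meson open_contains_ball)
    \<comment> \<open>Small enough for \<open>spoke_step\<close>: the ball avoids the punctures, and
      also the real axis when \<open>p t\<close> is not on it.\<close>
    define r where "r = (if Im (p t) = 0 then r0 else min r0 \<bar>Im (p t)\<bar>)"
    have r: "r > 0" "ball (p t) r \<subseteq> X" "Im (p t) \<noteq> 0 \<Longrightarrow> r \<le> \<bar>Im (p t)\<bar>"
      using r0 by (auto simp: r_def)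
    obtain e where e: "e > 0" "\<And>s. s \<in> {0..1} \<Longrightarrow> \<bar>s - t\<bar> < e \<Longrightarrow> p s \<in> ball (p t) r"
      using p(1) t r(1) unfolding path_def continuous_on_iff
      by (metis dist_real_def dist_commute mem_ball)
    have "d s = d t \<otimes>\<^bsub>fundamental_group X \<i>\<^esub> pi1.c (p t) (p s)"
      if s: "s \<in> {0..1}" "\<bar>s - t\<bar> < e" for s
    proof -
      let ?q = "path_class X (subpath t s p)"
      have "path_image (subpath t s p) \<subseteq> ball (p t) r"
      proof -
        have "u \<in> {0..1} \<and> \<bar>u - t\<bar> < e" if "u \<in> closed_segment t s" for u
          using that s t by (auto simp: closed_segment_eq_real_ivl split: if_splits)
        then show ?thesis
          using e(2) by (auto simp: path_image_subpath_gen simp del: mem_ball)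
      qed
      then have c: "spoke (p t) \<star> ?q \<star> arrow_inv X (spoke (p s)) = pi1.c (p t) (p s)"
        using e(2)[OF s] r p(1) s t pX[OF t]
        by (intro spoke_step[of _ _ r]) (auto simp: pathstart_subpath pathfinish_subpath simp del: mem_ball)
      have G: "path_class X (subpath 0 t p) \<in> arrows X \<i> (p t)" using sub[of 0 t] t p by simp
      note T = spoke_p[OF t] and S = spoke_p[OF s(1)] and Q = sub[OF t s(1)]
      have "path_class X (subpath 0 t p) \<star> ?q = path_class X (subpath 0 t p +++ subpath t s p)"
        using p s t path_image_subpath_subset[of 0 t p] path_image_subpath_subset[of t s p]
        by (intro arrow_comp_path_class) (auto simp: pathstart_subpath pathfinish_subpath)
      also have "\<dots> = path_class X (subpath 0 s p)"
        using p s t by (intro path_class_eqI homotopic_join_subpaths) auto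
      finally have "d s = path_class X (subpath 0 t p) \<star> ?q \<star> arrow_inv X (spoke (p s))"
        by (simp add: d_def)
      also have "\<dots> = (path_class X (subpath 0 t p) \<star> arrow_inv X (spoke (p t)) \<star> spoke (p t)) \<star>
          ?q \<star> arrow_inv X (spoke (p s))"
        by (simp add: arrow_cancel(1)[OF T G])
      also have "\<dots> = d t \<star> (spoke (p t) \<star> ?q \<star> arrow_inv X (spoke (p s)))"
        unfolding d_def
        using arrow_comp_assoc[OF arrow_comp_closed[OF G arrow_inv_closed[OF T]] T Q]
          arrow_comp_assoc[OF arrow_comp_closed[OF G arrow_inv_closed[OF T]]
            arrow_comp_closed[OF T Q] arrow_inv_closed[OF S]] by simp
      finally show ?thesis by (simp add: c mult_fundamental_group)
    qed
    then show "\<exists>e>0. \<forall>s\<in>{0..1}. \<bar>s - t\<bar> < e \<longrightarrow> d s = d t \<otimes>\<^bsub>fundamental_group X \<i>\<^esub> pi1.c (p t) (p s)"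
      using e(1) by blast
  qed
  moreover have c: "spoke \<i> = path_class X (\<lambda>_. \<i>)"
    by (simp add: spoke_def linepath_def algebra_simps)
  moreover have "arrow_inv X (path_class X (\<lambda>_. \<i>)) = path_class X (\<lambda>_. \<i>)"
    using const_in_loops_at[OF i_in_punctured_plane, of k]
    by (subst arrow_inv_path_class) (auto simp: loops_at_def reversepath_def)
  moreover have "path_class X (\<lambda>_. \<i>) \<in> arrows X \<i> \<i>"
    using const_in_loops_at[OF i_in_punctured_plane, of k] by (auto simp: arrows_def loops_at_def)
  moreover have "path_class X p \<in> arrows X \<i> \<i>"
    using assms by (auto simp: arrows_def loops_at_def)
  ultimately have "pi1.development p 0 1 d" "d 0 = \<one>\<^bsub>fundamental_group X \<i>\<^esub>" "d 1 = path_class X p"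
    using p by (simp_all add: d_def subpath_def arrow_comp_id fundamental_group_simps)
  then show ?thesis
    using pi1.transport_eq p(2) by metis
qed

end

text \<open>Transport in the free group and evaluation of words are mutually inverse. One composite
  is computed on the loops \<open>gap_loop j\<close>. For the other, evaluation turns a development
  in the free group into one in the fundamental group, whose final value is the class of the
  loop.\<close>

theorem free_group_punctured_plane:
  "free_group {1..k} \<cong> fundamental_group (punctured_plane k) \<i>"
proof -
  let ?X = "punctured_plane k" and ?F = "free_group {1..k}"
  let ?a = "\<lambda>j::nat. if j = 0 then [] else [(j, True)]"
  let ?g = "\<lambda>j. path_class ?X (gap_loop j)"
  interpret P: punctured_plane_groupoid k .
  interpret F: crossing ?F k ?a
  proof -
    interpret group ?F by (rule group_free_group)
    show "crossing ?F k ?a" by unfold_locales (auto simp: reduced_Cons)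
  qed
  have g: "?g \<in> {1..k} \<rightarrow> carrier (fundamental_group ?X \<i>)"
    using P.pi1.a_closed by auto
  let ?e = "word_eval (fundamental_group ?X \<i>) ?g"
  have hom: "?e \<in> hom ?F (fundamental_group ?X \<i>)"
    using P.pi1.word_eval_hom[OF g] .
  then interpret e: group_hom ?F "fundamental_group ?X \<i>" ?e by unfold_locales
  have e_a: "?e (?a j) = ?g j" if "j \<le> k" for j
    using P.pi1.a_closed[OF that] P.pi1.a_0 by simp
  \<comment> \<open>Both cocycles are given by one formula, so it suffices that evaluation matches
    the contributions of the gaps; for gap 0 these are the empty word and the trivial class.\<close>
  have e_c: "?e (F.c x y) = P.pi1.c x y" for x y
    unfolding F.c_def P.pi1.c_def
    using e_a[OF gap_le] e.hom_inv[OF F.a_closed[OF gap_le]] e.hom_one by simp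
  show ?thesis
  proof (rule P.pi1.free_group_isoI[OF g F.on_class_transport_hom])
    fix j assume "j \<in> {1..k}"
    then show "on_class F.transport (?g j) = [(j, True)]"
      using F.on_class_transport[OF gap_loop_in_loops] F.transport_gap_loop[of j] by simp
  next
    fix A assume "A \<in> carrier (fundamental_group ?X \<i>)"
    then obtain p where p: "p \<in> loops_at ?X \<i>" "A = path_class ?X p"
      by (auto simp: fundamental_group_simps)
    then have pX: "path p" "path_image p \<subseteq> ?X" by (auto simp: loops_at_def)
    obtain d where d: "F.development p 0 1 d" "d 0 = \<one>\<^bsub>?F\<^esub>" "d 1 = F.transport p"
      using F.obtain_development[OF pX] .
    have "P.pi1.development p 0 1 (?e \<circ> d)"
      unfolding P.pi1.development_def
    proof (intro ballI conjI)
      fix t :: real assume t: "t \<in> {0..1}"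
      note dt = F.development_closed[OF d(1) t]
      show "(?e \<circ> d) t \<in> carrier (fundamental_group ?X \<i>)" using e.hom_closed[OF dt] by simp
      obtain e where e: "e > 0" "\<And>s. s \<in> {0..1} \<Longrightarrow> \<bar>s - t\<bar> < e \<Longrightarrow>
          d s = d t \<otimes>\<^bsub>?F\<^esub> F.c (p t) (p s)"
        using F.developmentE[OF d(1) t] by blast
      then show "\<exists>e>0. \<forall>s\<in>{0..1}. \<bar>s - t\<bar> < e \<longrightarrow>
          (?e \<circ> d) s = (?e \<circ> d) t \<otimes>\<^bsub>fundamental_group ?X \<i>\<^esub> P.pi1.c (p t) (p s)"
        using e.hom_mult[OF dt F.c_closed] e_c by (intro exI[of _ e]) (simp del: free_group_simps)
    qed
    then have "P.pi1.transport p = (?e \<circ> d) 1"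
      by (rule P.pi1.transport_eq) (use d pX e.hom_one in \<open>auto\<close>)
    then have "path_class ?X p = ?e (F.transport p)"
      using P.transport_eq_path_class[OF p(1)] d(3) by simp
    then show "?e (on_class F.transport A) = A"
      using F.on_class_transport[OF p(1)] p(2) by simp
  qed
qed

theorem is_free_group_complement_finite:
  fixes P :: "complex set"
  assumes "finite P" "z \<notin> P"
  shows "is_free_group (fundamental_group (- P) z)"
proof -
  obtain e where e: "bij_betw e {1..card P} P"
    using ex_bij_betw_nat_finite_1[OF assms(1)] by blast
  let ?k = "card P"
  \<comment> \<open>Index 0 is reserved for the base point, which is moved to \<open>\<i>\<close> by
    the same homeomorphism that moves \<open>P\<close> to the standard punctures.\<close>
  define x where "x j = (if j = 0 then z else e j)" for j :: nat
  define y where "y j = (if j = 0 then \<i> else of_nat j)" for j :: nat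
  have "bij_betw x {1..?k} P"
    using e by (rule bij_betw_cong[THEN iffD1, rotated]) (simp add: x_def)
  then have xP: "x ` {1..?k} = P" and x_inj: "inj_on x {1..?k}"
    by (simp_all add: bij_betw_def)
  have i: "\<i> \<noteq> of_nat j" "of_nat j \<noteq> \<i>" for j :: nat
    by (simp_all add: complex_eq_iff)
  have pw: "pairwise (\<lambda>i j. x i \<noteq> x j \<and> y i \<noteq> y j) {0..?k}"
    unfolding pairwise_def
  proof (intro ballI impI conjI)
    fix a b assume ab: "a \<in> {0..?k}" "b \<in> {0..?k}" "a \<noteq> b"
    have "x j \<in> P" if "j \<in> {0..?k}" "j \<noteq> 0" for j using xP that by auto
    moreover have "x 0 \<notin> P" using assms(2) by (simp add: x_def)
    ultimately have "x a \<noteq> x b" if "a = 0 \<or> b = 0" using ab that by metis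
    moreover have "x a \<noteq> x b" if "a \<noteq> 0" "b \<noteq> 0"
      using inj_onD[OF x_inj, of a b] ab that by auto
    ultimately show "x a \<noteq> x b" by blast
    show "y a \<noteq> y b" using ab(3) i by (auto simp: y_def)
  qed
  obtain f g where fg: "homeomorphism UNIV UNIV f g" "\<And>j. j \<in> {0..?k} \<Longrightarrow> f (x j) = y j"
    by (rule homeomorphism_moving_points_exists[OF _ open_UNIV connected_UNIV subset_UNIV _ _ pw subset_UNIV _ connected_UNIV])
      (auto intro: that)
  have "f ` P = of_nat ` {1..?k}"
  proof -
    have "f ` P = (\<lambda>j. f (x j)) ` {1..?k}" by (metis xP image_image)
    also have "\<dots> = of_nat ` {1..?k}" using fg(2) by (intro image_cong) (auto simp: y_def)
    finally show ?thesis .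
  qed
  moreover have bij: "bij f" using fg(1) by (metis homeomorphism_def bij_betw_def inj_on_def UNIV_I)
  ultimately have "f ` (- P) = punctured_plane ?k"
    by (simp add: bij_image_Compl_eq punctured_plane_def)
  then have "homeomorphism (- P) (punctured_plane ?k) f g"
    using homeomorphism_of_subsets[OF fg(1), of "- P" "punctured_plane ?k"] by simp
  then have "fundamental_group (punctured_plane ?k) (f z) \<cong> fundamental_group (- P) z"
    using assms(2) by (intro fundamental_group_homeomorphism) auto
  moreover have "f z = \<i>" using fg(2)[of 0] by (simp add: x_def y_def)
  ultimately have "free_group {1..?k} \<cong> fundamental_group (- P) z"
    using free_group_punctured_plane iso_trans by metis
  then show ?thesis
    using assms(2) by (intro is_free_groupI group_fundamental_group) auto
qed

text \<open>The second coordinate is contracted linearly to that of \<open>z\<close>, which keeps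
  the base point fixed.\<close>

lemma is_free_group_complement_finite_times_UNIV:
  fixes P :: "complex set" and z :: "complex \<times> complex"
  assumes "finite P" "z \<in> (- P) \<times> UNIV"
  shows "is_free_group (fundamental_group ((- P) \<times> UNIV) z)"
proof -
  have "fundamental_group (- P) (fst z) \<cong> fundamental_group ((- P) \<times> (UNIV :: complex set)) z"
  proof (rule fundamental_group_deformation_retract[where g = "\<lambda>w. (w, snd z)"
        and H = "\<lambda>(t, w). (fst w, (1 - t) *\<^sub>R snd w + t *\<^sub>R snd z)"])
    show "continuous_on ({0..1} \<times> ((- P) \<times> UNIV)) (\<lambda>(t, w). (fst w, (1 - t) *\<^sub>R snd w + t *\<^sub>R snd z))"
      unfolding case_prod_beta by (intro continuous_intros)
  qed (use assms in \<open>auto intro!: continuous_intros simp: prod_eq_iff algebra_simps\<close>)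
  moreover have "is_free_group (fundamental_group (- P) (fst z))"
    using assms by (intro is_free_group_complement_finite) auto
  ultimately show ?thesis
    using assms(2) by (intro is_free_group_iso[OF group_fundamental_group])
qed

section \<open>Affine line arrangements\<close>

text \<open>A triple with \<open>B i = C i = 0\<close> and \<open>A i \<noteq> 0\<close> imposes no
  condition: it stands for the line at infinity, so a projective arrangement keeps its index set in
  a chart.\<close>

definition affine_complement :: "'i set \<Rightarrow> ('i \<Rightarrow> complex) \<Rightarrow> ('i \<Rightarrow> complex) \<Rightarrow> ('i \<Rightarrow> complex) \<Rightarrow> (complex \<times> complex) set" where
  "affine_complement I A B C = {(x, y). \<forall>i\<in>I. A i + B i * x + C i * y \<noteq> 0}"

text \<open>On the complex line through two points of the complement, each form is nonzero at one of
  them and hence has at most one zero. A path of complex parameters from 0 to 1 avoids these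
  finitely many values.\<close>

lemma path_connected_affine_complement:
  assumes "finite I"
  shows "path_connected (affine_complement I A B C)"
  unfolding path_connected_def
proof (intro ballI)
  fix z w assume z: "z \<in> affine_complement I A B C" and w: "w \<in> affine_complement I A B C"
  define l where "l i v = A i + B i * fst v + C i * snd v" for i and v :: "complex \<times> complex"
  have lz: "l i z \<noteq> 0" "l i w \<noteq> 0" if "i \<in> I" for i
    using z w that by (auto simp: affine_complement_def l_def case_prod_beta)
  define \<phi> where "\<phi> u = ((1 - u) * fst z + u * fst w, (1 - u) * snd z + u * snd w)" for u
  have l\<phi>: "l i (\<phi> u) = (1 - u) * l i z + u * l i w" for i u
    by (simp add: l_def \<phi>_def algebra_simps)
  define Z where "Z = (\<lambda>i. l i z / (l i z - l i w)) ` {i \<in> I. l i z \<noteq> l i w}"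
  have in_compl: "\<phi> u \<in> affine_complement I A B C" if "u \<notin> Z" for u
  proof -
    have "l i (\<phi> u) \<noteq> 0" if i: "i \<in> I" for i
    proof
      assume "l i (\<phi> u) = 0"
      then have *: "u * (l i z - l i w) = l i z" by (simp add: l\<phi> algebra_simps)
      then have ne: "l i z \<noteq> l i w" using lz(1)[OF i] by auto
      then have "u = l i z / (l i z - l i w)" using * by (simp add: eq_divide_eq)
      then have "u \<in> Z" unfolding Z_def using i ne by (intro image_eqI[where x = i]) simp_all
      then show False using \<open>u \<notin> Z\<close> by contradiction
    qed
    then show ?thesis by (auto simp: affine_complement_def l_def case_prod_beta)
  qed
  have "countable Z"
    using assms by (intro countable_finite) (simp add: Z_def)
  then have conn: "path_connected (- Z)"
    by (intro path_connected_complement_countable) simp_all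
  have "u \<in> - Z" if u: "u = 0 \<or> u = 1" for u
  proof
    assume "u \<in> Z"
    then obtain i where i: "i \<in> I" "l i z \<noteq> l i w" "u = l i z / (l i z - l i w)" unfolding Z_def by blast
    then have "u * (l i z - l i w) = l i z" by simp
    then show False using lz[OF i(1)] u by auto
  qed
  then have "0 \<in> - Z" "1 \<in> - Z" by simp_all
  with conn obtain r where r: "path r" "path_image r \<subseteq> - Z" "pathstart r = 0" "pathfinish r = 1"
    unfolding path_connected_def by metis
  have "path (\<phi> \<circ> r)"
    using r(1) unfolding \<phi>_def by (intro path_continuous_image continuous_intros)
  moreover have "path_image (\<phi> \<circ> r) \<subseteq> affine_complement I A B C"
    using r(2) in_compl by (auto simp: path_image_compose)
  moreover have "pathstart (\<phi> \<circ> r) = z" "pathfinish (\<phi> \<circ> r) = w"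
    using r(3,4) by (simp_all add: pathstart_compose pathfinish_compose \<phi>_def)
  ultimately show "\<exists>g. path g \<and> path_image g \<subseteq> affine_complement I A B C \<and> pathstart g = z \<and> pathfinish g = w"
    by blast
qed

text \<open>Lines missing the origin also miss a small torus. On a line through the origin with
  \<open>c \<noteq> 0\<close>, the term \<open>c * y\<close> of size |c| e dominates
  \<open>b * x\<close> of size |b| e^2, which is why one radius is squared. The remaining line x = 0
  is avoided because the radius is positive.\<close>

lemma eventually_small_torus:
  fixes a b c :: complex
  assumes "a \<noteq> 0 \<or> b \<noteq> 0 \<or> c \<noteq> 0"
  shows "\<forall>\<^sub>F e in at_right 0. \<forall>x y. cmod x = e\<^sup>2 \<longrightarrow> cmod y = e \<longrightarrow> a + b * x + c * y \<noteq> 0"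
proof -
  have pos: "\<forall>\<^sub>F e in at_right (0::real). 0 < e"
    by (simp add: eventually_at_right_less)
  consider "a \<noteq> 0" | "a = 0" "c \<noteq> 0" | "a = 0" "c = 0" "b \<noteq> 0" using assms by blast
  then show ?thesis
  proof cases
    case 1
    have "((\<lambda>e. cmod b * e\<^sup>2 + cmod c * e) \<longlongrightarrow> 0) (at_right 0)"
      by (auto intro!: tendsto_eq_intros)
    then have "\<forall>\<^sub>F e in at_right 0. cmod b * e\<^sup>2 + cmod c * e < cmod a"
      using 1 by (intro order_tendstoD) auto
    then show ?thesis
    proof eventually_elim
      case (elim e)
      show ?case
      proof (intro allI impI notI)
        fix x y assume "cmod x = e\<^sup>2" "cmod y = e" "a + b * x + c * y = 0"
        then have "a = - (b * x + c * y)" by (simp only: eq_neg_iff_add_eq_0 add.assoc)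
        then have "cmod a \<le> cmod (b * x) + cmod (c * y)" by (metis norm_minus_cancel norm_triangle_ineq)
        then show False using elim \<open>cmod x = _\<close> \<open>cmod y = _\<close> by (simp add: norm_mult)
      qed
    qed
  next
    case 2
    have "((\<lambda>e. cmod b * e) \<longlongrightarrow> 0) (at_right 0)"
      by (auto intro!: tendsto_eq_intros)
    then have "\<forall>\<^sub>F e in at_right 0. cmod b * e < cmod c"
      using 2 by (intro order_tendstoD) auto
    with pos show ?thesis
    proof eventually_elim
      case (elim e)
      show ?case
      proof (intro allI impI notI)
        fix x y assume xy: "cmod x = e\<^sup>2" "cmod y = e" "a + b * x + c * y = 0"
        then have "b * x = - (c * y)" using 2 by (simp add: eq_neg_iff_add_eq_0)
        then have "cmod b * cmod x = cmod c * cmod y" by (metis norm_minus_cancel norm_mult)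
        then have "(cmod b * e) * e = cmod c * e" using xy by (simp add: power2_eq_square)
        then show False using elim by simp
      qed
    qed
  next
    case 3
    from pos show ?thesis
      by eventually_elim (use 3 in auto)
  qed
qed

lemma not_is_free_group_affine_complement:
  assumes I: "finite I" and nz: "\<And>i. i \<in> I \<Longrightarrow> A i \<noteq> 0 \<or> B i \<noteq> 0 \<or> C i \<noteq> 0"
    and axes: "\<And>x y. (x, y) \<in> affine_complement I A B C \<Longrightarrow> x \<noteq> 0 \<and> y \<noteq> 0"
    and z: "z \<in> affine_complement I A B C"
  shows "\<not> is_free_group (fundamental_group (affine_complement I A B C) z)"
proof
  let ?T = "affine_complement I A B C"
  assume free: "is_free_group (fundamental_group ?T z)"
  have "\<forall>\<^sub>F e in at_right 0. \<forall>i\<in>I. \<forall>x y. cmod x = e\<^sup>2 \<longrightarrow> cmod y = e \<longrightarrow> A i + B i * x + C i * y \<noteq> 0"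
    using I nz by (intro eventually_ball_finite ballI eventually_small_torus)
  then have "\<forall>\<^sub>F e in at_right 0. e > 0 \<and> (\<forall>i\<in>I. \<forall>x y. cmod x = e\<^sup>2 \<longrightarrow> cmod y = e \<longrightarrow> A i + B i * x + C i * y \<noteq> 0)"
    by (intro eventually_conj eventually_at_right_less)
  from eventually_happens'[OF trivial_limit_at_right_real this]
  obtain e where e: "e > 0"
    and e_nz: "\<forall>i\<in>I. \<forall>x y. cmod x = e\<^sup>2 \<longrightarrow> cmod y = e \<longrightarrow> A i + B i * x + C i * y \<noteq> 0"
    by blast
  have torus: "(x, y) \<in> ?T" if "cmod x = e\<^sup>2" "cmod y = e" for x y
    using e_nz that by (simp add: affine_complement_def)
  \<comment> \<open>The torus is parametrised by the real plane with period 1 in each variable, so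
    that homotopies can be found in a convex set and pushed forward.\<close>
  define Q where "Q v = (circlepath 0 (e\<^sup>2) (fst v), circlepath 0 e (snd v))" for v
  have Q_cont: "continuous_on UNIV Q"
    unfolding Q_def circlepath by (intro continuous_intros)
  have Q_T: "Q v \<in> ?T" for v
    unfolding Q_def using e by (intro torus) (auto simp: circlepath norm_mult norm_power)
  let ?z0 = "Q (0, 0)"
  have Q_per: "Q (s, 1) = Q (s, 0)" "Q (1, s) = Q (0, s)" for s
    by (simp_all add: Q_def circlepath)
  define \<alpha> where "\<alpha> = Q \<circ> linepath (0, 0) (1, 0)"
  define \<beta> where "\<beta> = Q \<circ> linepath (0, 0) (0, 1)"
  have Q_lin: "path (Q \<circ> linepath u v)" "path_image (Q \<circ> linepath u v) \<subseteq> ?T"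
    "pathstart (Q \<circ> linepath u v) = Q u" "pathfinish (Q \<circ> linepath u v) = Q v" for u v
    using Q_cont Q_T
    by (auto intro!: path_continuous_image intro: continuous_on_subset
        simp: path_image_compose pathstart_compose pathfinish_compose)
  have loops: "path \<alpha>" "path_image \<alpha> \<subseteq> ?T" "pathstart \<alpha> = ?z0" "pathfinish \<alpha> = ?z0"
    "path \<beta>" "path_image \<beta> \<subseteq> ?T" "pathstart \<beta> = ?z0" "pathfinish \<beta> = ?z0"
    unfolding \<alpha>_def \<beta>_def using Q_lin Q_per by simp_all
  \<comment> \<open>The two ways along the boundary of the unit square are homotopic in the plane,
    and \<open>Q\<close> maps opposite edges to the same loop.\<close>
  have comm: "path_class ?T (\<alpha> +++ \<beta>) = path_class ?T (\<beta> +++ \<alpha>)"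
  proof (rule path_class_eqI)
    let ?p = "linepath (0, 0) (1, 0) +++ linepath (1, 0) (1, 1 :: real)"
    let ?q = "linepath (0, 0) (0, 1) +++ linepath (0, 1) (1, 1 :: real)"
    have "homotopic_paths (UNIV :: (real \<times> real) set) ?p ?q"
      using convex_imp_simply_connected[OF convex_UNIV]
      unfolding simply_connected_eq_homotopic_paths by (metis path_linepath path_join_imp
          pathfinish_join pathfinish_linepath pathstart_join pathstart_linepath subset_UNIV)
    then have "homotopic_paths ?T (Q \<circ> ?p) (Q \<circ> ?q)"
      by (rule homotopic_paths_continuous_image[OF _ Q_cont]) (use Q_T in auto)
    moreover have "Q \<circ> ?p = \<alpha> +++ \<beta>" "Q \<circ> ?q = \<beta> +++ \<alpha>"
      by (auto simp: \<alpha>_def \<beta>_def joinpaths_def linepath_def Q_def circlepath)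
    ultimately show "homotopic_paths ?T (\<alpha> +++ \<beta>) (\<beta> +++ \<alpha>)" by simp
  qed
  \<comment> \<open>The base point is arbitrary, so the loops on the torus are conjugated by a path
    leading there; this affects neither their commuting nor their winding numbers.\<close>
  obtain r where r: "path r" "path_image r \<subseteq> ?T" "pathstart r = z" "pathfinish r = ?z0"
    using path_connected_affine_complement[OF I] z Q_T unfolding path_connected_def by metis
  define a where "a = (r +++ \<alpha>) +++ reversepath r"
  define b where "b = (r +++ \<beta>) +++ reversepath r"
  have ab_loops: "a \<in> loops_at ?T z" "b \<in> loops_at ?T z"
    using r loops by (auto simp: a_def b_def loops_at_def subset_path_image_join)
  let ?G = "fundamental_group ?T z"
  have ab: "path_class ?T a \<in> carrier ?G" "path_class ?T b \<in> carrier ?G"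
    using ab_loops by (auto simp: fundamental_group_simps)
  define R where "R = path_class ?T r"
  have R: "R \<in> arrows ?T z ?z0" and \<alpha>\<beta>: "path_class ?T \<alpha> \<in> arrows ?T ?z0 ?z0" "path_class ?T \<beta> \<in> arrows ?T ?z0 ?z0"
    unfolding R_def using r loops by (auto intro: path_class_in_arrows)
  have R': "arrow_inv ?T R \<in> arrows ?T ?z0 z" by (rule arrow_inv_closed[OF R])
  have conj: "path_class ?T ((r +++ \<gamma>) +++ reversepath r) = arrow_comp ?T (arrow_comp ?T R (path_class ?T \<gamma>)) (arrow_inv ?T R)"
    if "path \<gamma>" "path_image \<gamma> \<subseteq> ?T" "pathstart \<gamma> = ?z0" "pathfinish \<gamma> = ?z0" for \<gamma>
    using that r by (simp add: R_def arrow_comp_path_class arrow_inv_path_class subset_path_image_join)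
  have conj_mult: "arrow_comp ?T (arrow_comp ?T (arrow_comp ?T R U) (arrow_inv ?T R)) (arrow_comp ?T (arrow_comp ?T R V) (arrow_inv ?T R))
      = arrow_comp ?T (arrow_comp ?T R (arrow_comp ?T U V)) (arrow_inv ?T R)"
    if U: "U \<in> arrows ?T ?z0 ?z0" and V: "V \<in> arrows ?T ?z0 ?z0" for U V
  proof -
    note RU = arrow_comp_closed[OF R U] and RV = arrow_comp_closed[OF R V]
    show ?thesis
      using arrow_comp_assoc[OF arrow_comp_closed[OF RU R'] RV R']
        arrow_comp_assoc[OF arrow_comp_closed[OF RU R'] R V]
        arrow_comp_assoc[OF R U V] arrow_cancel(1)[OF R RU] by simp
  qed
  have "path_class ?T a \<otimes>\<^bsub>?G\<^esub> path_class ?T b = path_class ?T b \<otimes>\<^bsub>?G\<^esub> path_class ?T a"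
  proof -
    have "arrow_comp ?T (path_class ?T \<alpha>) (path_class ?T \<beta>) = arrow_comp ?T (path_class ?T \<beta>) (path_class ?T \<alpha>)"
      using comm loops by (simp add: arrow_comp_path_class)
    then show ?thesis
      using loops by (simp add: mult_fundamental_group a_def b_def conj conj_mult \<alpha>\<beta>)
  qed
  \<comment> \<open>Well defined on classes of loops because, by \<open>axes\<close>, neither
    coordinate vanishes on the complement.\<close>
  moreover define wind where "wind h = on_class (\<lambda>p. winding_number (h \<circ> p) 0)"
    for h :: "complex \<times> complex \<Rightarrow> complex"
  have h_paths: "path (h \<circ> p)" "0 \<notin> path_image (h \<circ> p)"
    if "path p" "path_image p \<subseteq> ?T" "h = fst \<or> h = snd" for h p
  proof -
    have "continuous_on (path_image p) h" using that(3) by (auto intro!: continuous_intros)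
    then show "path (h \<circ> p)" by (rule path_continuous_image[OF that(1)])
    show "0 \<notin> path_image (h \<circ> p)"
      using that axes by (force simp: path_image_compose)
  qed
  have wind: "wind h (path_class ?T p) = winding_number (h \<circ> p) 0"
    if "p \<in> loops_at ?T z" "h = fst \<or> h = snd" for h p
    unfolding wind_def
  proof (rule on_class_path_class[OF that(1)])
    fix q assume pq: "homotopic_paths ?T p q"
    have "homotopic_paths (- {0}) (h \<circ> p) (h \<circ> q)"
      by (rule homotopic_paths_continuous_image[OF pq])
        (use that(2) axes in \<open>auto intro!: continuous_intros\<close>)
    then show "winding_number (h \<circ> q) 0 = winding_number (h \<circ> p) 0"
      by (metis winding_number_homotopic_paths)
  qed
  have join: "h \<circ> (p +++ q) = (h \<circ> p) +++ (h \<circ> q)" for h :: "complex \<times> complex \<Rightarrow> complex" and p q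
    by (auto simp: joinpaths_def)
  have wn_join: "winding_number (h \<circ> (p +++ q)) 0 = winding_number (h \<circ> p) 0 + winding_number (h \<circ> q) 0"
    if "path p" "path_image p \<subseteq> ?T" "path q" "path_image q \<subseteq> ?T" "pathfinish p = pathstart q" "h = fst \<or> h = snd" for h p q
    unfolding join using that h_paths
    by (intro winding_number_join) (auto simp: pathstart_compose pathfinish_compose)
  have wind_mult: "wind h (U \<otimes>\<^bsub>?G\<^esub> V) = wind h U + wind h V"
    if UV: "U \<in> carrier ?G" "V \<in> carrier ?G" and h: "h = fst \<or> h = snd" for h U V
  proof -
    obtain p q where pq: "p \<in> loops_at ?T z" "q \<in> loops_at ?T z" "U = path_class ?T p" "V = path_class ?T q"
      using UV by (auto simp: fundamental_group_simps)
    then have "winding_number (h \<circ> (p +++ q)) 0 = winding_number (h \<circ> p) 0 + winding_number (h \<circ> q) 0"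
      using h by (intro wn_join) (auto simp: loops_at_def)
    then show ?thesis
      using pq h by (simp add: mult_path_class wind join_in_loops_at)
  qed
  have wind_conj: "wind h (path_class ?T ((r +++ \<gamma>) +++ reversepath r)) = winding_number (h \<circ> \<gamma>) 0"
    if \<gamma>: "path \<gamma>" "path_image \<gamma> \<subseteq> ?T" "pathstart \<gamma> = ?z0" "pathfinish \<gamma> = ?z0" and h: "h = fst \<or> h = snd" for h \<gamma>
  proof -
    have "(r +++ \<gamma>) +++ reversepath r \<in> loops_at ?T z"
      using \<gamma> r by (auto simp: loops_at_def subset_path_image_join)
    moreover have "winding_number (h \<circ> reversepath r) 0 = - winding_number (h \<circ> r) 0"
      using winding_number_reversepath[OF h_paths[OF r(1,2) h]]
      by (simp add: reversepath_def o_def)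
    ultimately show ?thesis
      using \<gamma> r h by (simp add: wind wn_join subset_path_image_join)
  qed
  have Q_circle: "fst \<circ> \<alpha> = circlepath 0 (e\<^sup>2)" "snd \<circ> \<alpha> = linepath (of_real e) (of_real e)"
     "snd \<circ> \<beta> = circlepath 0 e" "fst \<circ> \<beta> = linepath (of_real (e\<^sup>2)) (of_real (e\<^sup>2))"
    by (auto simp: \<alpha>_def \<beta>_def Q_def linepath_def circlepath algebra_simps)
  have "wind fst (path_class ?T a) = 1" "wind snd (path_class ?T a) = 0"
    "wind snd (path_class ?T b) = 1" "wind fst (path_class ?T b) = 0"
    unfolding a_def b_def using loops e
    by (simp_all add: wind_conj Q_circle winding_number_circlepath_centre winding_number_trivial)
  ultimately show False
    using is_free_group_commute[OF free wind_mult[where h = fst] wind_mult[where h = snd] ab] by simp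
qed

section \<open>Complements of projective line arrangements\<close>

text \<open>Bilinear, without conjugation: \<open>a\<close> acts as the linear form that cuts out a
  line, as in \<open>proj_line\<close>.\<close>

definition dot :: "complex ^ 3 \<Rightarrow> complex ^ 3 \<Rightarrow> complex" where
  "dot a v = (\<Sum>i\<in>UNIV. a $ i * v $ i)"

text \<open>For independent forms this is the intersection point of their lines, and
  \<open>dot e (ccross a b)\<close> is the determinant of three forms.\<close>

definition ccross :: "complex ^ 3 \<Rightarrow> complex ^ 3 \<Rightarrow> complex ^ 3" where
  "ccross a b = vector [a $ 2 * b $ 3 - a $ 3 * b $ 2, a $ 3 * b $ 1 - a $ 1 * b $ 3, a $ 1 * b $ 2 - a $ 2 * b $ 1]"

lemma dot_3: "dot a v = a $ 1 * v $ 1 + a $ 2 * v $ 2 + a $ 3 * v $ 3"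
  by (simp add: dot_def sum_3)

lemma ccross_nth [simp]:
  "ccross a b $ 1 = a $ 2 * b $ 3 - a $ 3 * b $ 2"
  "ccross a b $ 2 = a $ 3 * b $ 1 - a $ 1 * b $ 3"
  "ccross a b $ 3 = a $ 1 * b $ 2 - a $ 2 * b $ 1"
  by (simp_all add: ccross_def vector_3)

lemma dot_scale [simp]: "dot a (c *s v) = c * dot a v" "dot (c *s a) v = c * dot a v"
  by (simp_all add: dot_3 algebra_simps)

lemma dot_add [simp]: "dot a (v + w) = dot a v + dot a w"
  by (simp add: dot_3 algebra_simps)

lemma dot_zero [simp]: "dot a 0 = 0" "dot 0 v = 0"
  by (simp_all add: dot_3)

lemma dot_ccross [simp]: "dot a (ccross a b) = 0" "dot b (ccross a b) = 0"
  by (simp_all add: dot_3 algebra_simps)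

lemma dot_ccross_rotate: "dot a (ccross b e) = dot e (ccross a b)"
  by (simp add: dot_3 algebra_simps)

text \<open>Cramer's rule: for determinant 1 the three cross products are the basis dual to the
  forms \<open>a\<close>, \<open>b\<close>, \<open>e\<close>.\<close>

lemma dual_basis:
  assumes "dot e (ccross a b) = 1"
  shows "v = dot a v *s ccross b e + dot b v *s ccross e a + dot e v *s ccross a b"
proof -
  have "dot e (ccross a b) *s v = dot a v *s ccross b e + dot b v *s ccross e a + dot e v *s ccross a b"
    by (simp add: vec_eq_iff forall_3 dot_3 algebra_simps)
  then show ?thesis using assms by simp
qed

lemma ex_dot_eq_1: "a \<noteq> 0 \<Longrightarrow> \<exists>y. dot a y = 1"
proof -
  assume "a \<noteq> 0"
  then obtain i where "a $ i \<noteq> 0" by (auto simp: vec_eq_iff)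
  moreover have "dot a (axis i (1 / a $ i)) = a $ i * (1 / a $ i)"
    unfolding dot_def by (subst sum.remove[of _ i]) (auto simp: axis_def)
  ultimately have "dot a (axis i (1 / a $ i)) = 1" by simp
  then show ?thesis ..
qed

text \<open>With \<open>dot a w = 0\<close> and \<open>dot a y = 1\<close> this exhibits
  \<open>w\<close> as the cross product of \<open>a\<close> with a further form.\<close>

lemma ccross_ccross: "ccross a (ccross w y) = dot a y *s w - dot a w *s y"
  by (simp add: vec_eq_iff forall_3 dot_3 algebra_simps)

section \<open>Functions and continuity on the projective plane\<close>

lemma abs_cp2_scale: "c \<noteq> 0 \<Longrightarrow> v \<noteq> 0 \<Longrightarrow> abs_cp2 (c *s v) = abs_cp2 v"
  using abs_cp2_eq_iff[of v "c *s v"] by auto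

lemma abs_cp2_in_line_iff:
  assumes "v \<noteq> 0"
  shows "abs_cp2 v \<in> abs_cp2 ` {v. v \<noteq> 0 \<and> dot a v = 0} \<longleftrightarrow> dot a v = 0"
proof
  assume "abs_cp2 v \<in> abs_cp2 ` {v. v \<noteq> 0 \<and> dot a v = 0}"
  then obtain w where w: "w \<noteq> 0" "dot a w = 0" "abs_cp2 w = abs_cp2 v" by force
  then obtain c where "v = c *s w" using abs_cp2_eq_iff[of w v] assms by auto
  then show "dot a v = 0" using w by simp
qed (use assms in auto)

text \<open>An affine coordinate; by homogeneity the chosen representative does not matter. On the
  line of \<open>e\<close> division yields the default value 0.\<close>

definition ratio :: "complex ^ 3 \<Rightarrow> complex ^ 3 \<Rightarrow> cp2 \<Rightarrow> complex" where
  "ratio a e p = dot a (rep_cp2 p) / dot e (rep_cp2 p)"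

lemma ratio_abs_cp2:
  assumes "v \<noteq> 0"
  shows "ratio a e (abs_cp2 v) = dot a v / dot e v"
proof -
  have "proj_rel (rep_cp2 (abs_cp2 v)) (rep_cp2 (abs_cp2 v))"
    using Quotient_cp2 by (rule Quotient_rep_reflp)
  then have "rep_cp2 (abs_cp2 v) \<noteq> 0" by (simp add: proj_rel_def)
  moreover have "abs_cp2 (rep_cp2 (abs_cp2 v)) = abs_cp2 v"
    using Quotient_cp2 by (rule Quotient_abs_rep)
  ultimately obtain c where "v = c *s rep_cp2 (abs_cp2 v)"
    using abs_cp2_eq_iff assms by metis
  moreover from this have "c \<noteq> 0" using assms by (metis vector_smult_lzero)
  ultimately show ?thesis
    unfolding ratio_def by (metis dot_scale(1) mult_divide_mult_cancel_left)
qed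

lemma continuous_on_dot [continuous_intros]:
  "continuous_on S f \<Longrightarrow> continuous_on S (\<lambda>x. dot a (f x))"
  unfolding dot_3 by (intro continuous_intros)

lemma continuous_on_scalar_mult [continuous_intros]:
  fixes v :: "'a :: real_normed_algebra ^ 'n"
  shows "continuous_on S f \<Longrightarrow> continuous_on S (\<lambda>x. f x *s v)"
  unfolding vector_scalar_mult_def by (intro continuous_intros)

lemma continuous_on_abs_cp2: "continuous_on (- {0}) abs_cp2"
  using quotient_imp_continuous_map[OF quotient_map_abs_cp2] by simp

text \<open>The universal property of the quotient topology over an open set: preimages are tested
  in homogeneous coordinates.\<close>

lemma continuous_on_cp2:
  assumes "open U" and "continuous_on {v. v \<noteq> 0 \<and> abs_cp2 v \<in> U} (\<lambda>v. h (abs_cp2 v))"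
  shows "continuous_on U h"
  unfolding continuous_on_open_vimage[OF assms(1)]
proof (intro allI impI)
  fix B :: "'a set" assume "open B"
  have "open {v. v \<noteq> 0 \<and> abs_cp2 v \<in> U}" using assms(1) by (simp add: open_cp2_def)
  then have "open ((\<lambda>v. h (abs_cp2 v)) -` B \<inter> {v. v \<noteq> 0 \<and> abs_cp2 v \<in> U})"
    using assms(2) \<open>open B\<close> by (simp add: continuous_on_open_vimage)
  moreover have "(\<lambda>v. h (abs_cp2 v)) -` B \<inter> {v. v \<noteq> 0 \<and> abs_cp2 v \<in> U} = {v. v \<noteq> 0 \<and> abs_cp2 v \<in> h -` B \<inter> U}"
    by auto
  ultimately show "open (h -` B \<inter> U)" by (simp add: open_cp2_def)
qed

section \<open>Line complements and their affine charts\<close>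

definition proj_complement :: "'i set \<Rightarrow> ('i \<Rightarrow> complex ^ 3) \<Rightarrow> cp2 set" where
  "proj_complement I c = abs_cp2 ` {v. v \<noteq> 0 \<and> (\<forall>i\<in>I. dot (c i) v \<noteq> 0)}"

lemma abs_cp2_in_proj_complement_iff:
  assumes "v \<noteq> 0"
  shows "abs_cp2 v \<in> proj_complement I c \<longleftrightarrow> (\<forall>i\<in>I. dot (c i) v \<noteq> 0)"
proof
  assume "abs_cp2 v \<in> proj_complement I c"
  then obtain w where w: "w \<noteq> 0" "\<forall>i\<in>I. dot (c i) w \<noteq> 0" "abs_cp2 v = abs_cp2 w"
    by (auto simp: proj_complement_def)
  then obtain l where "w = l *s v" using abs_cp2_eq_iff[of v w] assms by auto
  then show "\<forall>i\<in>I. dot (c i) v \<noteq> 0" using w by auto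
qed (use assms in \<open>auto simp: proj_complement_def\<close>)

lemma open_proj_complement:
  assumes "finite I"
  shows "open (proj_complement I c)"
proof -
  have "{v. v \<noteq> 0 \<and> abs_cp2 v \<in> proj_complement I c} = - {0} \<inter> (\<Inter>i\<in>I. {v. dot (c i) v \<noteq> 0})"
    using abs_cp2_in_proj_complement_iff by auto
  moreover have "open (- {0} \<inter> (\<Inter>i\<in>I. {v. dot (c i) v \<noteq> 0}))"
    using assms by (intro open_Int open_INT ballI open_Collect_neq continuous_intros) auto
  ultimately show ?thesis by (simp add: open_cp2_def)
qed

text \<open>The line of \<open>e\<close> becomes the line at infinity; no point of the complement
  lies on it, so one chart covers everything. The inverse map sends \<open>(x, y)\<close> to the
  vector on which \<open>a\<close>, \<open>b\<close>, \<open>e\<close> take the values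
  \<open>x\<close>, \<open>y\<close>, 1.\<close>

lemma proj_complement_chart:
  fixes a b e :: "complex ^ 3" and I :: "'i set" and c :: "'i \<Rightarrow> complex ^ 3"
  defines "T \<equiv> affine_complement I (\<lambda>i. dot (c i) (ccross a b)) (\<lambda>i. dot (c i) (ccross b e)) (\<lambda>i. dot (c i) (ccross e a))"
  assumes I: "finite I" and abe: "dot e (ccross a b) = 1"
    and e: "\<And>v. (\<forall>i\<in>I. dot (c i) v \<noteq> 0) \<Longrightarrow> dot e v \<noteq> 0"
  shows "homeomorphism (proj_complement I c) T (\<lambda>p. (ratio a e p, ratio b e p))
    (\<lambda>(x, y). abs_cp2 (x *s ccross b e + y *s ccross e a + ccross a b))"
proof -
  define q where "q x y = x *s ccross b e + y *s ccross e a + ccross a b" for x y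
  have q_dot: "dot a (q x y) = x" "dot b (q x y) = y" "dot e (q x y) = 1" for x y
    using abe by (simp_all add: q_def dot_ccross_rotate[of a] dot_ccross_rotate[of b])
  then have q_nz: "q x y \<noteq> 0" for x y by (metis dot_zero(1) zero_neq_one)
  have cq: "dot (c i) (q x y) = dot (c i) (ccross a b) + dot (c i) (ccross b e) * x + dot (c i) (ccross e a) * y" for i x y
    by (simp add: q_def algebra_simps)
  have q_in: "abs_cp2 (q x y) \<in> proj_complement I c \<longleftrightarrow> (x, y) \<in> T" for x y
    by (simp add: abs_cp2_in_proj_complement_iff[OF q_nz] T_def affine_complement_def cq)
  have rep: "\<exists>x y. p = abs_cp2 (q x y)" if "p \<in> proj_complement I c" for p
  proof -
    obtain v where v: "v \<noteq> 0" "\<forall>i\<in>I. dot (c i) v \<noteq> 0" "p = abs_cp2 v"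
      using \<open>p \<in> _\<close> by (auto simp: proj_complement_def)
    have ev: "dot e v \<noteq> 0" using e v by blast
    have "v = dot e v *s q (dot a v / dot e v) (dot b v / dot e v)"
      by (subst dual_basis[OF abe, of v]) (use ev in \<open>simp add: q_def vector_add_ldistrib vector_smult_assoc\<close>)
    then have "abs_cp2 v = abs_cp2 (q (dot a v / dot e v) (dot b v / dot e v))"
      using abs_cp2_scale[OF ev q_nz] by metis
    then show ?thesis using v by blast
  qed
  let ?f = "\<lambda>p. (ratio a e p, ratio b e p)"
  let ?g = "\<lambda>(x, y). abs_cp2 (q x y)"
  have fg: "?f (abs_cp2 (q x y)) = (x, y)" for x y
    by (simp add: ratio_abs_cp2[OF q_nz] q_dot)
  have cont_ratio: "continuous_on (proj_complement I c) (ratio d e)" for d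
  proof (rule continuous_on_cp2[OF open_proj_complement[OF I]])
    let ?V = "{v. v \<noteq> 0 \<and> abs_cp2 v \<in> proj_complement I c}"
    have "continuous_on ?V (\<lambda>v. dot d v / dot e v)"
      using e by (intro continuous_intros ballI) (auto simp: abs_cp2_in_proj_complement_iff)
    then show "continuous_on ?V (\<lambda>v. ratio d e (abs_cp2 v))"
      by (rule continuous_on_eq) (simp add: ratio_abs_cp2)
  qed
  have "homeomorphism (proj_complement I c) T ?f ?g"
    unfolding homeomorphism_def
  proof (intro conjI ballI)
    show "continuous_on (proj_complement I c) ?f"
      by (intro continuous_on_Pair cont_ratio)
    have "continuous_on UNIV (\<lambda>v. q (fst v) (snd v))"
      unfolding q_def by (intro continuous_intros)
    then have "continuous_on UNIV (\<lambda>v. abs_cp2 (q (fst v) (snd v)))"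
      by (rule continuous_on_compose2[OF continuous_on_abs_cp2]) (use q_nz in auto)
    then show "continuous_on T ?g"
      by (auto simp: case_prod_beta intro: continuous_on_subset)
    show "?f ` proj_complement I c = T"
    proof (intro equalityI subsetI)
      fix w assume "w \<in> ?f ` proj_complement I c"
      then obtain x y where "abs_cp2 (q x y) \<in> proj_complement I c" "w = ?f (abs_cp2 (q x y))"
        using rep by blast
      then show "w \<in> T" by (simp only: fg q_in)
    next
      fix w assume "w \<in> T"
      then have "abs_cp2 (q (fst w) (snd w)) \<in> proj_complement I c" by (simp add: q_in)
      moreover have "w = ?f (abs_cp2 (q (fst w) (snd w)))" by (simp add: fg)
      ultimately show "w \<in> ?f ` proj_complement I c" by (rule rev_image_eqI)
    qed
    show "?g ` T = proj_complement I c"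
    proof (intro equalityI subsetI)
      fix p assume "p \<in> ?g ` T"
      then obtain x y where "(x, y) \<in> T" "p = abs_cp2 (q x y)" by auto
      then show "p \<in> proj_complement I c" by (simp add: q_in)
    next
      fix p assume p: "p \<in> proj_complement I c"
      then obtain x y where xy: "p = abs_cp2 (q x y)" using rep by blast
      then have "(x, y) \<in> T" using p by (simp add: q_in)
      then show "p \<in> ?g ` T" by (rule rev_image_eqI) (simp add: xy)
    qed
  next
    fix p assume "p \<in> proj_complement I c"
    then obtain x y where xy: "p = abs_cp2 (q x y)" using rep by blast
    show "?g (?f p) = p" unfolding xy fg by simp
  next
    fix w assume "w \<in> T"
    then show "?f (?g w) = w" by (simp only: case_prod_beta fg prod.collapse)
  qed
  then show ?thesis by (simp add: q_def)
qed

text \<open>The line of \<open>c i0\<close> goes to infinity and takes \<open>w\<close> along, which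
  becomes the direction of the second coordinate axis. The coefficient of that coordinate in form
  \<open>i\<close> is \<open>dot (c i) w\<close>, which is 0.\<close>

lemma is_free_group_concurrent:
  assumes I: "finite I" "i0 \<in> I" and c: "\<And>i. i \<in> I \<Longrightarrow> c i \<noteq> 0"
    and w: "w \<noteq> 0" "\<And>i. i \<in> I \<Longrightarrow> dot (c i) w = 0"
    and x: "x \<in> proj_complement I c"
  shows "is_free_group (fundamental_group (proj_complement I c) x)"
proof -
  let ?a = "c i0"
  obtain y where y: "dot ?a y = 1" using ex_dot_eq_1 c I(2) by blast
  obtain e where e: "dot e w = 1"
    using ex_dot_eq_1[OF w(1)] by (metis dot_3 mult.commute)
  \<comment> \<open>Chosen so that \<open>ccross ?a ?b\<close> is \<open>w\<close>; together with
    \<open>dot e w = 1\<close> this gives determinant 1.\<close>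
  let ?b = "ccross w y"
  have ab: "ccross ?a ?b = w" using y w(2)[OF I(2)] by (simp add: ccross_ccross)
  have det: "dot ?a (ccross ?b e) = 1" using e ab by (simp add: dot_ccross_rotate)
  \<comment> \<open>The first coordinates of the vertical lines. The excluded indices,
    \<open>i0\<close> among them, belong to the line at infinity.\<close>
  define P where "P = (\<lambda>i. - dot (c i) (ccross ?b e) / dot (c i) (ccross e ?a)) ` {i \<in> I. dot (c i) (ccross e ?a) \<noteq> 0}"
  let ?T = "affine_complement I (\<lambda>i. dot (c i) (ccross ?b e)) (\<lambda>i. dot (c i) (ccross e ?a)) (\<lambda>i. dot (c i) (ccross ?a ?b))"
  have nz: "dot (c i) (ccross ?b e) \<noteq> 0 \<or> dot (c i) (ccross e ?a) \<noteq> 0" if i: "i \<in> I" for i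
  proof (rule ccontr)
    assume *: "\<not> ?thesis"
    obtain v where v: "dot (c i) v = 1" using ex_dot_eq_1 c[OF i] by blast
    have "dot e (ccross ?a ?b) = 1" using e ab by simp
    from dual_basis[OF this, of v] have "dot (c i) v = dot (c i) (dot ?a v *s ccross ?b e + dot ?b v *s ccross e ?a + dot e v *s w)"
      using ab by simp
    also have "\<dots> = 0" using * w(2)[OF i] by simp
    finally show False using v by simp
  qed
  have T: "?T = (- P) \<times> UNIV"
  proof -
    have "(dot (c i) (ccross ?b e) + dot (c i) (ccross e ?a) * u \<noteq> 0) \<longleftrightarrow>
        (dot (c i) (ccross e ?a) \<noteq> 0 \<longrightarrow> u \<noteq> - dot (c i) (ccross ?b e) / dot (c i) (ccross e ?a))"
      if "i \<in> I" for i u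
    proof (cases "dot (c i) (ccross e ?a) = 0")
      case False
      then have "u = - dot (c i) (ccross ?b e) / dot (c i) (ccross e ?a) \<longleftrightarrow>
          u * dot (c i) (ccross e ?a) = - dot (c i) (ccross ?b e)"
        by (rule nonzero_eq_divide_eq)
      also have "\<dots> \<longleftrightarrow> dot (c i) (ccross ?b e) + dot (c i) (ccross e ?a) * u = 0"
        by (metis add.commute eq_neg_iff_add_eq_0 mult.commute)
      finally show ?thesis using False by blast
    qed (use nz[OF that] in simp)
    then show ?thesis
      by (auto simp: affine_complement_def P_def ab w(2))
  qed
  have "homeomorphism (proj_complement I c) ?T (\<lambda>p. (ratio ?b ?a p, ratio e ?a p))
    (\<lambda>(x, y). abs_cp2 (x *s ccross e ?a + y *s ccross ?a ?b + ccross ?b e))"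
    using I by (intro proj_complement_chart[OF I(1) det]) blast
  from fundamental_group_homeomorphism[OF this x]
  have "fundamental_group ?T (ratio ?b ?a x, ratio e ?a x) \<cong> fundamental_group (proj_complement I c) x" .
  moreover have "(ratio ?b ?a x, ratio e ?a x) \<in> ?T"
    using \<open>homeomorphism _ _ _ _\<close> x by (force simp: homeomorphism_def)
  then have "is_free_group (fundamental_group ?T (ratio ?b ?a x, ratio e ?a x))"
    unfolding T using I(1) by (intro is_free_group_complement_finite_times_UNIV) (auto simp: P_def)
  ultimately show ?thesis
    using x by (intro is_free_group_iso[OF group_fundamental_group])
qed

text \<open>A line different from the first one meets it in a single point, which some third line
  misses. If there were no different line, all forms would be proportional and any point of the
  first line would be a common one.\<close>

lemma ex_independent_triple:
  assumes i0: "i0 \<in> I" "c i0 \<noteq> 0" and no_zero: "\<And>w. w \<noteq> 0 \<Longrightarrow> \<exists>i\<in>I. dot (c i) w \<noteq> 0"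
  shows "\<exists>j\<in>I. \<exists>l\<in>I. dot (c l) (ccross (c i0) (c j)) \<noteq> 0"
proof (cases "\<exists>j\<in>I. ccross (c i0) (c j) \<noteq> 0")
  case True
  then show ?thesis using no_zero by blast
next
  case False
  let ?a = "c i0"
  obtain y where y: "dot ?a y = 1" using ex_dot_eq_1[OF i0(2)] by blast
  have "\<exists>b. ccross ?a b \<noteq> 0"
  proof (rule ccontr)
    assume "\<nexists>b. ccross ?a b \<noteq> 0"
    then have "ccross ?a (vector [1, 0, 0]) = 0" "ccross ?a (vector [0, 1, 0]) = 0" by blast+
    then have "?a = 0" by (simp add: vec_eq_iff forall_3 vector_3)
    then show False using i0 by simp
  qed
  then obtain b where b: "ccross ?a b \<noteq> 0" by blast
  then obtain i where i: "i \<in> I" "dot (c i) (ccross ?a b) \<noteq> 0" using no_zero by blast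
  \<comment> \<open>The Binet-Cauchy identity, in which one of the two products vanishes because
    \<open>dot ?a (ccross ?a b) = 0\<close>.\<close>
  have "dot (c i) (ccross ?a b) * dot ?a y = - dot (ccross ?a (c i)) (ccross (ccross ?a b) y)"
    by (simp add: dot_3 algebra_simps)
  then have "dot (c i) (ccross ?a b) = 0" using False i y by simp
  then show ?thesis using i by simp
qed

lemma not_is_free_group_not_concurrent:
  assumes I: "finite I" "i0 \<in> I" and c: "\<And>i. i \<in> I \<Longrightarrow> c i \<noteq> 0"
    and no_zero: "\<And>w. w \<noteq> 0 \<Longrightarrow> \<exists>i\<in>I. dot (c i) w \<noteq> 0"
    and x: "x \<in> proj_complement I c"
  shows "\<not> is_free_group (fundamental_group (proj_complement I c) x)"
proof
  assume free: "is_free_group (fundamental_group (proj_complement I c) x)"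
  obtain j l where jl: "j \<in> I" "l \<in> I" and d: "dot (c l) (ccross (c i0) (c j)) \<noteq> 0"
    using ex_independent_triple[OF I(2) c[OF I(2)] no_zero] by blast
  let ?a = "c i0" and ?b = "c j"
  \<comment> \<open>Rescaling a form keeps its line; the factor normalises the determinant to
    1.\<close>
  define e where "e = (1 / dot (c l) (ccross ?a ?b)) *s c l"
  have det: "dot e (ccross ?a ?b) = 1" using d by (simp add: e_def)
  let ?T = "affine_complement I (\<lambda>i. dot (c i) (ccross ?a ?b)) (\<lambda>i. dot (c i) (ccross ?b e)) (\<lambda>i. dot (c i) (ccross e ?a))"
  have hom: "homeomorphism (proj_complement I c) ?T (\<lambda>p. (ratio ?a e p, ratio ?b e p))
    (\<lambda>(x, y). abs_cp2 (x *s ccross ?b e + y *s ccross e ?a + ccross ?a ?b))"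
    using jl d by (intro proj_complement_chart[OF I(1) det]) (auto simp: e_def)
  let ?x = "(ratio ?a e x, ratio ?b e x)"
  have xT: "?x \<in> ?T" using hom x by (force simp: homeomorphism_def)
  have "fundamental_group (proj_complement I c) x \<cong> fundamental_group ?T ?x"
    by (rule group.iso_sym[OF group_fundamental_group[OF xT] fundamental_group_homeomorphism[OF hom x]])
  then have "is_free_group (fundamental_group ?T ?x)"
    using free by (intro is_free_group_iso[OF group_fundamental_group[OF xT]])
  moreover have "\<not> is_free_group (fundamental_group ?T ?x)"
  proof (rule not_is_free_group_affine_complement[OF I(1) _ _ xT])
    fix i assume i: "i \<in> I"
    show "dot (c i) (ccross ?a ?b) \<noteq> 0 \<or> dot (c i) (ccross ?b e) \<noteq> 0 \<or> dot (c i) (ccross e ?a) \<noteq> 0"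
    proof (rule ccontr)
      assume *: "\<not> ?thesis"
      obtain v where v: "dot (c i) v = 1" using ex_dot_eq_1 c[OF i] by blast
      have "dot (c i) v = dot (c i) (dot ?a v *s ccross ?b e + dot ?b v *s ccross e ?a + dot e v *s ccross ?a ?b)"
        using dual_basis[OF det, of v] by simp
      also have "\<dots> = 0" using * by simp
      finally show False using v by simp
    qed
  next
    fix u v assume "(u, v) \<in> ?T"
    then have uv: "\<forall>i\<in>I. dot (c i) (ccross ?a ?b) + dot (c i) (ccross ?b e) * u + dot (c i) (ccross e ?a) * v \<noteq> 0"
      by (simp add: affine_complement_def)
    \<comment> \<open>In this chart the forms \<open>c i0\<close> and \<open>c j\<close> are
      multiples of the two coordinates, so both axes belong to the arrangement.\<close>
    show "u \<noteq> 0 \<and> v \<noteq> 0"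
      using bspec[OF uv I(2)] bspec[OF uv jl(1)] by auto
  qed
  ultimately show False by simp
qed

theorem theorem3:
  fixes n :: nat and L :: "nat \<Rightarrow> cp2 set" and x :: cp2
  assumes "n \<ge> 1"
    and "\<And>i. i \<in> {1..n} \<Longrightarrow> proj_line (L i)"
    and "x \<in> - (\<Union>i\<in>{1..n}. L i)"
  shows "is_free_group (fundamental_group (- (\<Union>i\<in>{1..n}. L i)) x) \<longleftrightarrow>
    (\<Inter>i\<in>{1..n}. L i) \<noteq> {}"
proof -
  let ?I = "{1..n}"
  have "\<forall>i\<in>?I. \<exists>a. a \<noteq> 0 \<and> L i = abs_cp2 ` {v. v \<noteq> 0 \<and> dot a v = 0}"
    using assms(2) by (simp add: proj_line_def dot_def)
  from bchoice[OF this] obtain c where c: "\<And>i. i \<in> ?I \<Longrightarrow> c i \<noteq> 0"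
    and L: "\<And>i. i \<in> ?I \<Longrightarrow> L i = abs_cp2 ` {v. v \<noteq> 0 \<and> dot (c i) v = 0}"
    by blast
  have in_L: "abs_cp2 v \<in> L i \<longleftrightarrow> dot (c i) v = 0" if "v \<noteq> 0" "i \<in> ?I" for v i
    using L that by (simp add: abs_cp2_in_line_iff)
  have compl: "- (\<Union>i\<in>?I. L i) = proj_complement ?I c"
  proof (rule Set.set_eqI)
    fix p
    obtain v where v: "v \<noteq> 0" "p = abs_cp2 v" by (rule cp2_exhaust)
    then show "p \<in> - (\<Union>i\<in>?I. L i) \<longleftrightarrow> p \<in> proj_complement ?I c"
      using in_L by (simp add: abs_cp2_in_proj_complement_iff)
  qed
  \<comment> \<open>The line singled out for both directions: it is sent to infinity in the
    concurrent case and becomes an axis in the other.\<close>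
  have one: "1 \<in> ?I" using assms(1) by simp
  have x: "x \<in> proj_complement ?I c" using assms(3) unfolding compl .
  show ?thesis
  proof
    assume free: "is_free_group (fundamental_group (- (\<Union>i\<in>?I. L i)) x)"
    have "\<exists>w. w \<noteq> 0 \<and> (\<forall>i\<in>?I. dot (c i) w = 0)"
      using not_is_free_group_not_concurrent[OF finite_atLeastAtMost one c _ x] free
      unfolding compl by blast
    then obtain w where "w \<noteq> 0" "\<forall>i\<in>?I. dot (c i) w = 0" by blast
    then have "abs_cp2 w \<in> (\<Inter>i\<in>?I. L i)" using in_L by simp
    then show "(\<Inter>i\<in>?I. L i) \<noteq> {}" by blast
  next
    assume "(\<Inter>i\<in>?I. L i) \<noteq> {}"
    then obtain p where p: "p \<in> (\<Inter>i\<in>?I. L i)" by blast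
    obtain w where w: "w \<noteq> 0" "p = abs_cp2 w" by (rule cp2_exhaust)
    then have cw: "dot (c i) w = 0" if "i \<in> ?I" for i using p in_L that by blast
    show "is_free_group (fundamental_group (- (\<Union>i\<in>?I. L i)) x)"
      unfolding compl by (rule is_free_group_concurrent[OF finite_atLeastAtMost one c w(1) cw x])
  qed
qed

end
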